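(* Let $s>5/2$ and let $(u_0,\rho_0)\in H_0^s(S^1)\times H^{s-1}(S^1)$. Let $f(t)=(f_1(t),f_2(t))$ denote the unique geodesic in $\mathcal S^{s-1}$ such that $$f(0)=(1,0),\qquad f_t(0)=\tfrac12(u_{0x},\rho_0).$$ Define $c\in\mathbb R$ by $$c=\langle\!\langle f_t(0),f_t(0)\rangle\!\rangle=\frac14\int_{S^1}(u_{0x}^2-\rho_0^2)\,dx.$$ Then $$f(t)=\begin{cases}\Bigl(\cos(\sqrt ct)+\frac{u_{0x}}{2\sqrt c}\sin(\sqrt ct),\ \frac{\rho_0}{2\sqrt c}\sin(\sqrt ct)\Bigr), & c>0\ \text{(spacelike)},\\[2mm] \Bigl(\frac{u_{0x}}{2}t+1,\ \frac{\rho_0}{2}t\Bigr), & c=0\ \text{(lightlike)},\\[2mm] \Bigl(\cosh(\sqrt{|c|}t)+\frac{u_{0x}}{2\sqrt{|c|}}\sinh(\sqrt{|c|}t),\ \frac{\rho_0}{2\sqrt{|c|}}\sinh(\sqrt{|c|}t)\Bigr), & c<0\ \text{(timelike)}.\end{cases}$$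
   Context: $S^1\simeq\mathbb R/\mathbb Z$; $H^s(S^1)$ is the $L_2$-based Sobolev space and $H_0^s(S^1)=\{u\in H^s(S^1):u(0)=0\}$. The unit pseudosphere is $\mathcal S=\{(f_1,f_2)\in L_2(S^1;\mathbb R^2):\int_{S^1}(f_1^2-f_2^2)\,dx=1\}$. For each Sobolev exponent $r$ used, $\mathcal S^r$ is the set of elements of $\mathcal S$ of class $H^r$, a Banach submanifold of $H^r(S^1;\mathbb R^2)$, equipped with the weak pseudo-Riemannian metric induced by the indefinite scalar product $\langle\!\langle X,Y\rangle\!\rangle=\int_{S^1}(X_1Y_1-X_2Y_2)\,dx$. The metric connection on $\mathcal S^r$ is $(\nabla_XY)(f)=(DY\cdot X)^T$, where for $Z\in T_fH^r(S^1;\mathbb R^2)$ the tangential part $Z^T=Z-\frac{\langle\!\langle Z,f\rangle\!\rangle}{\langle\!\langle f,f\rangle\!\rangle}f$ is the orthogonal projection onto $T_f\mathcal S^r=\{X\in H^r(S^1;\mathbb R^2):\int_{S^1}(f_1X_1-f_2X_2)\,dx=0\}$. A geodesic is a $C^2$-curve $f(t)$ in $\mathcal S^r$ with $\nabla_{f_t}f_t=(f_{tt})^T=0$. *)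

theory Defs
  imports "HOL-Analysis.Analysis"
begin

text \<open>Functions on the circle \<open>S\<^sup>1 = \<real>/\<int>\<close> are 1-periodic functions on the real line,
  and integrals over the circle are integrals over \<open>[0,1]\<close>.\<close>

definition L2_circle :: "(real \<Rightarrow> real) set" where
  "L2_circle = {u. (\<forall>x. u (x + 1) = u x) \<and> u \<in> borel_measurable borel \<and>
                   set_integrable lborel {0..1} (\<lambda>x. (u x)\<^sup>2)}"

definition fourier_coeff :: "(real \<Rightarrow> real) \<Rightarrow> int \<Rightarrow> complex" where
  "fourier_coeff u n =
     (LBINT x:{0..1}. complex_of_real (u x) * cis (- 2 * pi * of_int n * x))"

definition sobolev_weighted :: "real \<Rightarrow> (real \<Rightarrow> real) \<Rightarrow> int \<Rightarrow> real" where
  "sobolev_weighted r u n = (1 + (of_int n)\<^sup>2) powr r * (cmod (fourier_coeff u n))\<^sup>2"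

text \<open>\<open>H\<^sup>r(S\<^sup>1)\<close> for \<open>r \<ge> 0\<close>. An element of \<open>H\<^sup>r\<close> is a class of functions modulo equality almost
  everywhere; for \<open>r > 1/2\<close> each class contains exactly one continuous function, and that function
  represents the class. Thus point values, classical derivatives and equality of functions have
  their usual meaning for \<open>r > 1/2\<close>.\<close>

definition sobolev :: "real \<Rightarrow> (real \<Rightarrow> real) set" where
  "sobolev r = {u \<in> L2_circle. sobolev_weighted r u summable_on UNIV \<and>
                               (r > 1/2 \<longrightarrow> continuous_on UNIV u)}"

definition sobolev0 :: "real \<Rightarrow> (real \<Rightarrow> real) set" where
  "sobolev0 r = {u \<in> sobolev r. u 0 = 0}"

definition sobolev_norm :: "real \<Rightarrow> (real \<Rightarrow> real) \<Rightarrow> real" where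
  "sobolev_norm r u = sqrt (infsum (sobolev_weighted r u) UNIV)"

definition sobolev2 :: "real \<Rightarrow> (real \<Rightarrow> real \<times> real) set" where
  "sobolev2 r = {f. (\<lambda>x. fst (f x)) \<in> sobolev r \<and> (\<lambda>x. snd (f x)) \<in> sobolev r}"

definition sobolev2_norm :: "real \<Rightarrow> (real \<Rightarrow> real \<times> real) \<Rightarrow> real" where
  "sobolev2_norm r f =
     sqrt ((sobolev_norm r (\<lambda>x. fst (f x)))\<^sup>2 + (sobolev_norm r (\<lambda>x. snd (f x)))\<^sup>2)"

definition indef_inner :: "(real \<Rightarrow> real \<times> real) \<Rightarrow> (real \<Rightarrow> real \<times> real) \<Rightarrow> real" where
  "indef_inner X Y = (LBINT x:{0..1}. fst (X x) * fst (Y x) - snd (X x) * snd (Y x))"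

definition pseudosphere :: "(real \<Rightarrow> real \<times> real) set" where
  "pseudosphere = {f. (\<lambda>x. fst (f x)) \<in> L2_circle \<and> (\<lambda>x. snd (f x)) \<in> L2_circle \<and>
                      (LBINT x:{0..1}. (fst (f x))\<^sup>2 - (snd (f x))\<^sup>2) = 1}"

definition sobolev_pseudosphere :: "real \<Rightarrow> (real \<Rightarrow> real \<times> real) set" where
  "sobolev_pseudosphere r = pseudosphere \<inter> sobolev2 r"

definition tangential_part ::
    "(real \<Rightarrow> real \<times> real) \<Rightarrow> (real \<Rightarrow> real \<times> real) \<Rightarrow> real \<Rightarrow> real \<times> real" where
  "tangential_part f Z = (\<lambda>x. Z x - (indef_inner Z f / indef_inner f f) *\<^sub>R f x)"

text \<open>Curves in \<open>H\<^sup>r(S\<^sup>1;\<real>\<^sup>2)\<close> have type \<open>real \<Rightarrow> real \<Rightarrow> real \<times> real\<close>, time first. The derivative is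
  the limit of difference quotients in the \<open>H\<^sup>r\<close> norm, not merely a pointwise one.\<close>

definition has_sobolev_derivative ::
    "real \<Rightarrow> (real \<Rightarrow> real \<Rightarrow> real \<times> real) \<Rightarrow> (real \<Rightarrow> real \<times> real) \<Rightarrow> real \<Rightarrow> bool" where
  "has_sobolev_derivative r f v t \<longleftrightarrow>
     v \<in> sobolev2 r \<and>
     ((\<lambda>h. sobolev2_norm r (\<lambda>x. (f (t + h) x - f t x) /\<^sub>R h - v x)) \<longlongrightarrow> 0) (at 0)"

text \<open>\<open>f\<close> is a \<open>C\<^sup>2\<close> curve in \<open>H\<^sup>r(S\<^sup>1;\<real>\<^sup>2)\<close> on the open interval \<open>J\<close>, with \<open>f\<^sub>t = v\<close> and \<open>f\<^sub>t\<^sub>t = a\<close>.\<close>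

definition C2_sobolev_curve ::
    "real \<Rightarrow> real set \<Rightarrow> (real \<Rightarrow> real \<Rightarrow> real \<times> real) \<Rightarrow> (real \<Rightarrow> real \<Rightarrow> real \<times> real) \<Rightarrow>
     (real \<Rightarrow> real \<Rightarrow> real \<times> real) \<Rightarrow> bool" where
  "C2_sobolev_curve r J f v a \<longleftrightarrow>
     (\<forall>t\<in>J. f t \<in> sobolev2 r \<and>
            has_sobolev_derivative r f (v t) t \<and>
            has_sobolev_derivative r v (a t) t \<and>
            ((\<lambda>\<tau>. sobolev2_norm r (\<lambda>x. a \<tau> x - a t x)) \<longlongrightarrow> 0) (at t))"

text \<open>The geodesic equation is \<open>\<nabla>\<^bsub>f\<^sub>t\<^esub> f\<^sub>t = (f\<^sub>t\<^sub>t)\<^sup>T = 0\<close>.\<close>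

definition geodesic :: "real \<Rightarrow> real set \<Rightarrow> (real \<Rightarrow> real \<Rightarrow> real \<times> real) \<Rightarrow> bool" where
  "geodesic r J f \<longleftrightarrow>
     (\<exists>v a. C2_sobolev_curve r J f v a \<and>
            (\<forall>t\<in>J. f t \<in> sobolev_pseudosphere r \<and> tangential_part (f t) (a t) = (\<lambda>x. 0)))"

definition geodesic_from ::
    "real \<Rightarrow> real set \<Rightarrow> (real \<Rightarrow> real \<times> real) \<Rightarrow> (real \<Rightarrow> real \<times> real) \<Rightarrow>
     (real \<Rightarrow> real \<Rightarrow> real \<times> real) \<Rightarrow> bool" where
  "geodesic_from r J p w f \<longleftrightarrow>
     geodesic r J f \<and> f 0 = p \<and> has_sobolev_derivative r f w 0"

end

theory Submission
  imports Defs
begin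

text \<open>Along a geodesic \<open>f\<close> the acceleration is \<open>\<lambda> f\<close> with \<open>\<lambda> = \<langle>\<langle>f\<^sub>t\<^sub>t, f\<rangle>\<rangle>\<close>.
  Differentiating \<open>\<langle>\<langle>f, f\<rangle>\<rangle> = 1\<close> twice gives \<open>\<lambda> = - \<langle>\<langle>f\<^sub>t, f\<^sub>t\<rangle>\<rangle>\<close>, and
  \<open>\<langle>\<langle>f\<^sub>t, f\<^sub>t\<rangle>\<rangle>\<close> is constant because \<open>\<langle>\<langle>f, f\<^sub>t\<rangle>\<rangle> = 0\<close>. The geodesic equation is
  thus \<open>f\<^sub>t\<^sub>t = - c f\<close>, which is linear with constant coefficients and has the stated solutions.

  All the analysis takes place in the Banach space of bounded continuous functions, into which
  \<open>H\<^sup>r\<close> embeds for \<open>r > 1/2\<close>. The embedding, and the fact that \<open>u\<^sub>0\<^sub>x\<close> lies in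
  \<open>H\<^sup>s\<^sup>-\<^sup>1\<close>, rest on the inversion of absolutely convergent Fourier series.\<close>

section \<open>Fourier series of continuous periodic functions\<close>

definition trig :: "int \<Rightarrow> real \<Rightarrow> complex" where
  "trig n x = cis (2 * pi * of_int n * x)"

lemma trig_0 [simp]: "trig 0 x = 1" "trig n 0 = 1"
  by (simp_all add: trig_def)

lemma norm_trig [simp]: "norm (trig n x) = 1"
  by (simp add: trig_def)

lemma trig_mult: "trig m x * trig n x = trig (m + n) x"
  by (simp add: trig_def cis_mult algebra_simps)

lemma trig_periodic [simp]: "trig n (x + 1) = trig n x"
proof -
  have "trig n (x + 1) = cis (2 * pi * of_int n * x) * cis (2 * pi * of_int n)"
    by (simp add: trig_def cis_mult algebra_simps)
  then show ?thesis
    by (simp add: trig_def)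
qed

lemma has_vector_derivative_trig:
  "(trig n has_vector_derivative 2 * pi * of_int n * \<i> * trig n x) (at x within S)"
proof -
  have "((\<lambda>x. cis (2 * pi * of_int n * x)) has_vector_derivative
          2 * pi * of_int n * \<i> * cis (2 * pi * of_int n * x)) (at x within S)"
    unfolding has_vector_derivative_def
    by (rule derivative_eq_intros refl ext)+ (auto simp: scaleR_conv_of_real algebra_simps)
  then show ?thesis
    by (simp add: trig_def[abs_def])
qed

lemma continuous_on_trig [continuous_intros]: "continuous_on S (trig n)"
  by (rule differentiable_imp_continuous_on)
     (auto simp: differentiable_on_def intro: differentiableI_vector has_vector_derivative_trig)

lemma has_integral_trig:
  assumes "a \<le> b"
  shows "((\<lambda>x. 2 * pi * of_int n * \<i> * trig n x) has_integral (trig n b - trig n a)) {a..b}"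
  using assms by (intro fundamental_theorem_of_calculus has_vector_derivative_trig)

text \<open>For nonzero n the character is a constant multiple of its own derivative, which
  integrates to 0 over a full period.\<close>

lemma integral_trig: "integral {0..1} (trig n) = (if n = 0 then 1 else 0)"
proof (cases "n = 0")
  case True
  then have "trig n = (\<lambda>x. 1)"
    by auto
  with True show ?thesis
    by simp
next
  case False
  have "trig n 1 = 1"
    using trig_periodic[of n 0] by simp
  then have "((\<lambda>x. (2 * pi * of_int n * \<i>) * trig n x) has_integral 0) {0..1}"
    using has_integral_trig[of 0 1 n] by simp
  then have "integral {0..1} (\<lambda>x. (2 * pi * of_int n * \<i>) * trig n x) = 0"
    by (rule integral_unique)
  with False show ?thesis
    by simp
qed

text \<open>With a base point \<open>k\<close> to the left of everything, both integrals are
  differences of integrals starting at \<open>k\<close>. Translation by one period cancels all but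
  the integral over \<open>{k..k + 1}\<close>, which is the same in both cases.\<close>

lemma integral_periodic_shift:
  fixes h :: "real \<Rightarrow> 'a::banach"
  assumes "continuous_on UNIV h" "\<And>x. h (x + 1) = h x"
  shows "integral {a..a + 1} h = integral {0..1} h"
proof -
  have int: "h integrable_on {p..q}" for p q
    by (rule integrable_continuous_real) (rule continuous_on_subset[OF assms(1)], simp)
  have shift: "integral {p + 1..q + 1} h = integral {p..q} h" for p q
    using integral_shift_real_ivl[of "p + 1" 1 "q + 1" h] assms(2) by simp
  have *: "integral {p..q} h = integral {k..q} h - integral {k..p} h" if "k \<le> p" "p \<le> q" for k p q
    using Henstock_Kurzweil_Integration.integral_combine[of k p q h] int that
    by (simp add: eq_diff_eq add.commute)
  obtain k where k: "k + 1 \<le> a" "k + 1 \<le> 0"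
    by (rule that[of "min a 0 - 1"]) auto
  have "integral {a..a + 1} h = integral {k..a + 1} h - integral {k..a} h"
    "integral {0..1} h = integral {k..0 + 1} h - integral {k..0} h"
    using k by (subst *[of k]; simp)+
  moreover have "integral {k..a + 1} h = integral {k..k + 1} h + integral {k + 1..a + 1} h"
    using *[of k "k + 1" "a + 1"] k by simp
  moreover have "integral {k..0 + 1} h = integral {k..k + 1} h + integral {k + 1..0 + 1} h"
    using *[of k "k + 1" "0 + 1"] k by simp
  ultimately show ?thesis
    using shift[of k a] shift[of k 0] by simp
qed

text \<open>The change from the Lebesgue to the gauge integral gives access to the fundamental
  theorem of calculus and to integration of uniform limits.\<close>

lemma fourier_coeff_eq_integral:
  assumes "continuous_on UNIV u"
  shows "fourier_coeff u n = integral {0..1} (\<lambda>x. of_real (u x) * trig (- n) x)"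
proof -
  have "continuous_on {0..1} (\<lambda>x. of_real (u x) * trig (- n) x)"
    by (intro continuous_intros continuous_on_subset[OF assms] subset_UNIV)
  from set_borel_integral_eq_integral(2)[OF borel_integrable_atLeastAtMost'[OF this]]
  show ?thesis
    by (simp add: fourier_coeff_def trig_def)
qed

text \<open>Reflecting \<open>w\<close> at \<open>x0\<close> yields the even function \<open>g x = w (x0 + x) + w (x0 - x)\<close>, a
  continuous function of \<open>cos (2 * pi * x)\<close>. It is orthogonal to all powers of that cosine, hence,
  by polynomial approximation, to itself.\<close>

lemma periodic_eq_0_if_fourier_coeffs_0:
  fixes w :: "real \<Rightarrow> real"
  assumes cont: "continuous_on UNIV w" and per: "\<And>x. w (x + 1) = w x"
    and moments: "\<And>n. integral {0..1} (\<lambda>x. of_real (w x) * trig n x) = 0"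
  shows "w x0 = 0"
proof -
  have cw: "continuous_on S w" for S
    by (rule continuous_on_subset[OF cont]) simp
  have cwg: "continuous_on S (\<lambda>x. w (g x))" if "continuous_on S g" for S :: "real set" and g
    by (rule continuous_on_compose2[OF cont that]) simp
  \<comment> \<open>The factor \<open>trig n\<close> stays in the statement for arbitrary n because
    a factor cosine is a combination of \<open>trig 1\<close> and \<open>trig (-1)\<close>: each
    induction step moves n to n + 1 and n - 1.\<close>
  have power_c: "integral {0..1} (\<lambda>y. of_real (w y) * trig n y * of_real (cos (2*pi*(y - x0))) ^ k) = 0"
    for n k
  proof (induction k arbitrary: n)
    case 0
    then show ?case
      using moments by simp
  next
    case (Suc k)
    have cos: "of_real (cos (2*pi*(y - x0)))
        = cis (-2*pi*x0) / 2 * trig 1 y + cis (2*pi*x0) / 2 * trig (-1) y" for y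
      by (simp add: trig_def complex_eq_iff cos_diff sin_diff algebra_simps flip: add_divide_distrib)
    have "(\<lambda>y. of_real (w y) * trig n y * of_real (cos (2*pi*(y - x0))) ^ Suc k)
       = (\<lambda>y. cis (-2*pi*x0) / 2 * (of_real (w y) * trig (n + 1) y * of_real (cos (2*pi*(y - x0))) ^ k)
           + cis (2*pi*x0) / 2 * (of_real (w y) * trig (n - 1) y * of_real (cos (2*pi*(y - x0))) ^ k))"
      (is "?L = ?R")
    proof
      fix y
      have "?L y = of_real (w y) * of_real (cos (2*pi*(y - x0))) ^ k *
              (cis (-2*pi*x0) / 2 * (trig n y * trig 1 y) + cis (2*pi*x0) / 2 * (trig n y * trig (-1) y))"
        unfolding power_Suc by (subst (1) cos) (simp add: algebra_simps)
      then show "?L y = ?R y"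
        by (simp only: trig_mult) (simp add: algebra_simps)
    qed
    moreover have "(\<lambda>y. of_real (w y) * trig m y * of_real (cos (2*pi*(y - x0))) ^ k) integrable_on {0..1}"
      for m
      by (intro integrable_continuous_real continuous_intros cw)
    ultimately show ?case
      using Suc.IH by (simp add: integral_add)
  qed
  have power: "integral {0..1} (\<lambda>y. w y * cos (2*pi*(y - x0)) ^ k) = 0" for k
  proof -
    have "integral {0..1} (\<lambda>y. complex_of_real (w y * cos (2*pi*(y - x0)) ^ k)) = 0"
      using power_c[of 0 k] by simp
    moreover have "((\<lambda>y. w y * cos (2*pi*(y - x0)) ^ k) has_integral
        integral {0..1} (\<lambda>y. w y * cos (2*pi*(y - x0)) ^ k)) {0..1}"
      by (intro integrable_integral integrable_continuous_real continuous_intros cw)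
    from has_integral_of_real[OF this, where 'b = complex]
    have "integral {0..1} (\<lambda>y. complex_of_real (w y * cos (2*pi*(y - x0)) ^ k))
        = of_real (integral {0..1} (\<lambda>y. w y * cos (2*pi*(y - x0)) ^ k))"
      by (rule integral_unique)
    ultimately show ?thesis
      by simp
  qed
  define g where "g x = w (x0 + x) + w (x0 - x)" for x
  have cg: "continuous_on S g" for S
    unfolding g_def by (intro continuous_intros cwg)
  have gpow: "integral {0..1} (\<lambda>x. g x * cos (2*pi*x) ^ k) = 0" for k
  proof -
    define h where "h y = w y * cos (2*pi*(y - x0)) ^ k" for y
    have ch: "continuous_on S h" for S
      unfolding h_def by (intro continuous_intros cw)
    have hper: "h (x + 1) = h x" for x
    proof -
      have "cos (2*pi*(x + 1 - x0)) = cos (2*pi*(x - x0) + 2*pi)"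
        by (simp add: algebra_simps)
      then show ?thesis
        by (simp add: h_def per)
    qed
    have 0: "integral {a..a+1} h = 0" for a
      using integral_periodic_shift[OF ch hper, of a] power[of k] by (simp add: h_def[abs_def])
    have "integral {0..1} (\<lambda>x. h (x + x0)) = integral {x0..x0+1} h"
      using integral_shift_real_ivl[of x0 x0 "x0+1" h] by simp
    then have 1: "integral {0..1} (\<lambda>x. h (x + x0)) = 0"
      using 0 by simp
    \<comment> \<open>The reflected summand runs over the period from x0 - 1 to x0.\<close>
    have "integral {0..1} (\<lambda>x. h (- x + x0)) = integral {-1..0} (\<lambda>x. h (x + x0))"
      using Henstock_Kurzweil_Integration.integral_reflect_real[of 0 "-1" "\<lambda>x. h (x + x0)"] by simp
    also have "\<dots> = integral {x0-1..x0-1+1} h"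
      using integral_shift_real_ivl[of "x0-1" x0 "x0" h] by simp
    finally have 2: "integral {0..1} (\<lambda>x. h (- x + x0)) = 0"
      using 0[of "x0 - 1"] by simp
    have "(\<lambda>x. g x * cos (2*pi*x) ^ k) = (\<lambda>x. h (x + x0) + h (- x + x0))"
      by (auto simp: g_def h_def algebra_simps)
    moreover have "continuous_on {0..1} (\<lambda>x. h (x + x0))" "continuous_on {0..1} (\<lambda>x. h (- x + x0))"
      by (intro continuous_on_compose2[OF ch[of UNIV]] continuous_intros; simp)+
    ultimately show ?thesis
      using 1 2 by (simp add: integral_add integrable_continuous_real)
  qed
  define G where "G y = g (arccos y / (2 * pi))" for y
  have cG: "continuous_on {-1..1} G"
    unfolding G_def
    by (intro continuous_on_compose2[OF cg[of UNIV]] continuous_intros) auto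
  \<comment> \<open>\<open>arccos\<close> recovers x only in the left half of the period. On the
    right half the symmetry g (1 - x) = g x, a consequence of periodicity, leads back to the left
    half.\<close>
  have Gcos: "G (cos (2*pi*x)) = g x" if "x \<in> {0..1}" for x
  proof (cases "x \<le> 1/2")
    case True
    then have "arccos (cos (2*pi*x)) = 2*pi*x"
      using that by (intro arccos_cos) auto
    then show ?thesis
      by (simp add: G_def)
  next
    case False
    have "cos (2*pi*x) = cos (2*pi*(1-x))"
      using cos_2pi_minus[of "2*pi*x"] by (simp add: algebra_simps)
    moreover have "arccos (cos (2*pi*(1-x))) = 2*pi*(1-x)"
      using that False by (intro arccos_cos) auto
    ultimately have "G (cos (2*pi*x)) = g (1 - x)"
      by (simp add: G_def)
    also have "\<dots> = g x"
      using per[of "x0 - x"] per[of "x0 + x - 1"] by (simp add: g_def algebra_simps)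
    finally show ?thesis .
  qed
  have "bounded (g ` {0..1})"
    by (intro compact_imp_bounded compact_continuous_image cg compact_Icc)
  then obtain M where M: "\<And>x. x \<in> {0..1} \<Longrightarrow> \<bar>g x\<bar> \<le> M"
    unfolding bounded_iff real_norm_def by blast
  have small: "integral {0..1} (\<lambda>x. g x ^ 2) \<le> M * e" if e: "e > 0" for e
  proof -
    obtain p where p: "real_polynomial_function p" "\<And>y. y \<in> {-1..1} \<Longrightarrow> \<bar>G y - p y\<bar> < e"
      by (rule Stone_Weierstrass_real_polynomial_function[OF compact_Icc cG e]) blast
    obtain a N where pN: "p = (\<lambda>y. \<Sum>i\<le>N. a i * y ^ i)"
      using p(1) unfolding real_polynomial_function_iff_sum by blast
    have "integral {0..1} (\<lambda>x. g x * p (cos (2*pi*x)))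
        = integral {0..1} (\<lambda>x. \<Sum>i\<le>N. a i * (g x * cos (2*pi*x) ^ i))"
      by (simp add: pN sum_distrib_left algebra_simps)
    also have "\<dots> = (\<Sum>i\<le>N. integral {0..1} (\<lambda>x. a i * (g x * cos (2*pi*x) ^ i)))"
      by (intro integral_sum integrable_continuous_real continuous_intros cg) auto
    also have "\<dots> = 0"
      by (simp add: gpow)
    finally have 0: "integral {0..1} (\<lambda>x. g x * p (cos (2*pi*x))) = 0" .
    have cp: "continuous_on S (\<lambda>x. p (cos (2*pi*x)))" for S
      unfolding pN by (intro continuous_intros)
    \<comment> \<open>Since g is orthogonal to p(cos), one factor g may be replaced by the small
      error g - p(cos).\<close>
    have "integral {0..1} (\<lambda>x. g x ^ 2) = integral {0..1} (\<lambda>x. g x ^ 2 - g x * p (cos (2*pi*x)))"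
      by (subst integral_diff)
         (auto simp: 0 intro!: integrable_continuous_real continuous_intros cg cp)
    also have "\<dots> \<le> integral {0..1::real} (\<lambda>x. M * e)"
    proof (rule Henstock_Kurzweil_Integration.integral_le)
      fix x :: real assume x: "x \<in> {0..1}"
      have "\<bar>g x - p (cos (2*pi*x))\<bar> < e"
        using p(2)[of "cos (2*pi*x)"] Gcos[OF x] by simp
      then have "\<bar>g x\<bar> * \<bar>g x - p (cos (2*pi*x))\<bar> \<le> M * e"
        using M[OF x] by (intro mult_mono) auto
      moreover have "g x ^ 2 - g x * p (cos (2*pi*x)) = g x * (g x - p (cos (2*pi*x)))"
        by (simp add: power2_eq_square algebra_simps)
      ultimately show "g x ^ 2 - g x * p (cos (2*pi*x)) \<le> M * e"
        by (metis abs_le_D1 abs_mult)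
    qed (auto intro!: integrable_continuous_real continuous_intros cg cp)
    also have "\<dots> = M * e"
      by simp
    finally show ?thesis .
  qed
  have "M \<ge> 0"
    using M[of 0] by simp
  have "integral {0..1} (\<lambda>x. g x ^ 2) \<le> 0"
  proof (rule field_le_epsilon)
    fix e :: real assume "e > 0"
    \<comment> \<open>The denominator M + 1 stays positive even if M = 0.\<close>
    then have "integral {0..1} (\<lambda>x. g x ^ 2) \<le> M * (e / (M + 1))"
      using \<open>M \<ge> 0\<close> by (intro small) simp
    also have "\<dots> \<le> e"
      using \<open>M \<ge> 0\<close> \<open>e > 0\<close> by (simp add: field_simps)
    finally show "integral {0..1} (\<lambda>x. g x ^ 2) \<le> 0 + e"
      by simp
  qed
  moreover have "integral {0..1} (\<lambda>x. g x ^ 2) \<ge> 0"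
    by (rule Henstock_Kurzweil_Integration.integral_nonneg) (auto intro!: integrable_continuous_real continuous_intros cg)
  ultimately have "integral {0..1} (\<lambda>x. g x ^ 2) = 0"
    by simp
  moreover have "continuous_on {0..1} (\<lambda>x. g x ^ 2)"
    by (intro continuous_intros cg)
  \<comment> \<open>A nonnegative continuous function with integral 0 vanishes everywhere; at 0 the
    value of g is twice w x0.\<close>
  ultimately have "g 0 = 0"
    using integral_eq_0_iff[of 0 1 "\<lambda>x. g x ^ 2"] by auto
  then show ?thesis
    by (simp add: g_def)
qed

section \<open>Absolutely convergent trigonometric series\<close>

text \<open>The Weierstrass M-test with majorants \<open>norm (a n)\<close> makes the net of finite
  partial sums converge uniformly. A bounded factor g preserves this, and integration commutes with
  uniform limits.\<close>

lemma
  fixes a :: "int \<Rightarrow> complex"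
  assumes "(\<lambda>n. norm (a n)) summable_on UNIV"
  shows continuous_on_trig_series: "continuous_on S (\<lambda>x. \<Sum>\<^sub>\<infinity>n. a n * trig n x)"
    and has_sum_integral_trig_series:
      "continuous_on {p..q} g \<Longrightarrow>
       ((\<lambda>n. integral {p..q} (\<lambda>x. a n * trig n x * g x)) has_sum
          integral {p..q} (\<lambda>x. (\<Sum>\<^sub>\<infinity>n. a n * trig n x) * g x)) UNIV"
proof -
  have unif: "uniform_limit S (\<lambda>X x. \<Sum>n\<in>X. a n * trig n x) (\<lambda>x. \<Sum>\<^sub>\<infinity>n. a n * trig n x)
      (finite_subsets_at_top UNIV)" for S
    by (rule Weierstrass_m_test_general[OF _ assms]) (simp add: norm_mult)
  have cont: "continuous_on A (\<lambda>x. \<Sum>\<^sub>\<infinity>n. a n * trig n x)" for A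
    by (rule uniform_limit_theorem[OF always_eventually unif])
       (intro allI continuous_intros, rule finite_subsets_at_top_neq_bot)
  then show "continuous_on S (\<lambda>x. \<Sum>\<^sub>\<infinity>n. a n * trig n x)" .
  assume g: "continuous_on {p..q} g"
  have "bounded (g ` {p..q})"
    by (intro compact_imp_bounded compact_continuous_image g compact_Icc)
  moreover have "bounded ((\<lambda>x. \<Sum>\<^sub>\<infinity>n. a n * trig n x) ` {p..q})"
    by (intro compact_imp_bounded compact_continuous_image cont compact_Icc)
  ultimately have "uniform_limit {p..q} (\<lambda>X x. (\<Sum>n\<in>X. a n * trig n x) * g x)
      (\<lambda>x. (\<Sum>\<^sub>\<infinity>n. a n * trig n x) * g x) (finite_subsets_at_top UNIV)"
    by (intro uniform_lim_mult unif uniform_limit_const)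
  then obtain I J where IJ:
      "\<And>X. ((\<lambda>x. (\<Sum>n\<in>X. a n * trig n x) * g x) has_integral I X) {p..q}"
      "((\<lambda>x. (\<Sum>\<^sub>\<infinity>n. a n * trig n x) * g x) has_integral J) {p..q}"
      "(I \<longlongrightarrow> J) (finite_subsets_at_top UNIV)"
    by (rule uniform_limit_integral) (intro continuous_intros g, rule finite_subsets_at_top_neq_bot, blast)
  \<comment> \<open>This holds for every set X: if X is infinite, both sums are 0 by convention.
    Hence \<open>I\<close> is literally the function \<open>sum\<close> whose limit defines
    \<open>has_sum\<close>.\<close>
  have "I X = (\<Sum>n\<in>X. integral {p..q} (\<lambda>x. a n * trig n x * g x))" for X
  proof -
    have "I X = integral {p..q} (\<lambda>x. (\<Sum>n\<in>X. a n * trig n x) * g x)"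
      by (rule integral_unique[OF IJ(1), symmetric])
    also have "\<dots> = integral {p..q} (\<lambda>x. \<Sum>n\<in>X. a n * trig n x * g x)"
      by (simp add: sum_distrib_right)
    also have "\<dots> = (\<Sum>n\<in>X. integral {p..q} (\<lambda>x. a n * trig n x * g x))"
    proof (cases "finite X")
      case True
      then show ?thesis
        by (intro integral_sum integrable_continuous_real continuous_intros g)
    qed simp
    finally show ?thesis .
  qed
  then have "I = sum (\<lambda>n. integral {p..q} (\<lambda>x. a n * trig n x * g x))"
    by (rule ext)
  then show "((\<lambda>n. integral {p..q} (\<lambda>x. a n * trig n x * g x)) has_sum
          integral {p..q} (\<lambda>x. (\<Sum>\<^sub>\<infinity>n. a n * trig n x) * g x)) UNIV"
    using IJ(2,3) by (simp add: has_sum_def integral_unique)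
qed

text \<open>Termwise integration against \<open>trig (- m)\<close> leaves, by orthogonality, only
  the term n = m.\<close>

lemma integral_trig_series:
  assumes "(\<lambda>n. norm (a n)) summable_on UNIV"
  shows "integral {0..1} (\<lambda>x. (\<Sum>\<^sub>\<infinity>n. a n * trig n x) * trig (- m) x) = a m"
proof -
  have "((\<lambda>n. integral {0..1} (\<lambda>x. a n * trig n x * trig (- m) x)) has_sum
          integral {0..1} (\<lambda>x. (\<Sum>\<^sub>\<infinity>n. a n * trig n x) * trig (- m) x)) UNIV"
    by (intro has_sum_integral_trig_series assms continuous_intros)
  moreover have "integral {0..1} (\<lambda>x. a n * trig n x * trig (- m) x) = (if n = m then a m else 0)" for n
    by (simp add: mult.assoc trig_mult integral_trig[of "n - m"])
  ultimately have "((\<lambda>n. if n = m then a m else 0) has_sum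
          integral {0..1} (\<lambda>x. (\<Sum>\<^sub>\<infinity>n. a n * trig n x) * trig (- m) x)) UNIV"
    by simp
  moreover have "((\<lambda>n. if n = m then a m else 0) has_sum a m) UNIV"
    by (rule has_sum_finite_neutralI[of "{m}"]) auto
  ultimately show ?thesis
    by (rule has_sum_unique)
qed

text \<open>The sum of the series is continuous and periodic and has the same Fourier coefficients
  as u, so the difference D has vanishing coefficients and is 0 by the uniqueness result.\<close>

lemma fourier_inversion:
  assumes cont: "continuous_on UNIV u" and per: "\<And>x. u (x + 1) = u x"
    and sum: "(\<lambda>n. norm (fourier_coeff u n)) summable_on UNIV"
  shows "of_real (u x) = (\<Sum>\<^sub>\<infinity>n. fourier_coeff u n * trig n x)"
proof -
  define S where "S x = (\<Sum>\<^sub>\<infinity>n. fourier_coeff u n * trig n x)" for x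
  have cS: "continuous_on A S" for A
    unfolding S_def[abs_def] by (rule continuous_on_trig_series[OF sum])
  have cu: "continuous_on A u" for A
    by (rule continuous_on_subset[OF cont]) simp
  have perS: "S (x + 1) = S x" for x
    by (simp add: S_def)
  have "integral {0..1} (\<lambda>x. S x * trig n x) = fourier_coeff u (- n)" for n
    using integral_trig_series[OF sum, of "- n"] by (simp add: S_def)
  moreover have "integral {0..1} (\<lambda>x. of_real (u x) * trig n x) = fourier_coeff u (- n)" for n
    using fourier_coeff_eq_integral[OF cont, of "- n"] by simp
  moreover have "integral {0..1} (\<lambda>x. (of_real (u x) - S x) * trig n x)
      = integral {0..1} (\<lambda>x. of_real (u x) * trig n x) - integral {0..1} (\<lambda>x. S x * trig n x)" for n
    unfolding left_diff_distrib
    by (intro integral_diff integrable_continuous_real continuous_intros cS cu)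
  ultimately have 0: "integral {0..1} (\<lambda>x. (of_real (u x) - S x) * trig n x) = 0" for n
    by simp
  \<comment> \<open>Uniqueness is available for real functions only. The real and imaginary parts of
    D are combinations of D and its conjugate, so the conjugate must have vanishing moments as
    well.\<close>
  have 1: "integral {0..1} (\<lambda>x. cnj (of_real (u x) - S x) * trig n x) = 0" for n
  proof -
    have "trig n x = cnj (trig (- n) x)" for x
      by (simp add: trig_def cis_cnj)
    then have "(\<lambda>x. cnj (of_real (u x) - S x) * trig n x) = (\<lambda>x. cnj ((of_real (u x) - S x) * trig (- n) x))"
      by simp
    then show ?thesis
      using 0[of "- n"] by (simp only: integral_cnj[symmetric] complex_cnj_zero)
  qed
  define D where "D x = of_real (u x) - S x" for x
  have cD: "continuous_on A D" for A
    unfolding D_def[abs_def] by (intro continuous_intros cS cu)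
  have perD: "D (x + 1) = D x" for x
    by (simp add: D_def per perS)
  note 01 = 0[folded D_def] 1[folded D_def]
  have iD: "(\<lambda>x. D x * trig n x) integrable_on {0..1}"
    "(\<lambda>x. cnj (D x) * trig n x) integrable_on {0..1}" for n
    by (intro integrable_continuous_real continuous_intros cD)+
  have "Re (D x) = 0"
  proof (rule periodic_eq_0_if_fourier_coeffs_0[where w = "\<lambda>x. Re (D x)"])
    have "of_real (Re z) = (z + cnj z) / 2" for z
      by (simp add: complex_eq_iff)
    then have "(\<lambda>x. of_real (Re (D x)) * trig n x) = (\<lambda>x. (D x * trig n x + cnj (D x) * trig n x) / 2)" for n
      by (simp only: distrib_right times_divide_eq_left)
    then show "integral {0..1} (\<lambda>x. complex_of_real (Re (D x)) * trig n x) = 0" for n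
      using 01 by (simp add: integral_add[OF iD])
  qed (simp_all add: perD cD continuous_on_Re continuous_on_Im)
  moreover have "Im (D x) = 0"
  proof (rule periodic_eq_0_if_fourier_coeffs_0[where w = "\<lambda>x. Im (D x)"])
    have "of_real (Im z) = (z - cnj z) / (2 * \<i>)" for z
      by (simp add: complex_eq_iff)
    then have "(\<lambda>x. of_real (Im (D x)) * trig n x)
        = (\<lambda>x. (D x * trig n x - cnj (D x) * trig n x) / (2 * \<i>))" for n
      by (simp only: left_diff_distrib times_divide_eq_left)
    then show "integral {0..1} (\<lambda>x. complex_of_real (Im (D x)) * trig n x) = 0" for n
      using 01 by (simp add: integral_diff[OF iD])
  qed (simp_all add: perD cD continuous_on_Re continuous_on_Im)
  ultimately have "D x = 0"
    by (simp add: complex_eq_iff)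
  then show ?thesis
    by (simp add: D_def S_def)
qed

text \<open>Away from 0 the weights are dominated by n to the power -2r, whose exponent is below -1.
  The integers are covered by two copies of the naturals, which may overlap at 0.\<close>

lemma summable_sobolev_weight:
  assumes "r > 1/2"
  shows "(\<lambda>n::int. (1 + (of_int n)\<^sup>2) powr (- r) :: real) summable_on UNIV"
proof -
  define w where "w n = (1 + (of_int n)\<^sup>2) powr (- r)" for n :: int
  have le: "(1 + (real n)\<^sup>2) powr (- r) \<le> real n powr (- 2 * r)" if "n \<ge> 1" for n
  proof -
    have "(1 + (real n)\<^sup>2) powr (- r) \<le> ((real n)\<^sup>2) powr (- r)"
      using that assms by (intro powr_mono2') auto
    also have "((real n)\<^sup>2) powr (- r) = (real n powr 2) powr (- r)"
      using that by simp
    also have "(real n powr 2) powr (- r) = real n powr (- 2 * r)"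
      by (subst powr_powr) simp
    finally show ?thesis .
  qed
  have "summable (\<lambda>n. real n powr (- 2 * r))"
    using assms by (subst summable_real_powr_iff) auto
  then have "summable (\<lambda>n. (1 + (real n)\<^sup>2) powr (- r))"
    by (rule summable_comparison_test'[where N = 1]) (use le in simp)
  then have nat: "(\<lambda>n. (1 + (real n)\<^sup>2) powr (- r)) summable_on UNIV"
    by (subst summable_on_UNIV_nonneg_real_iff) auto
  have "w summable_on range int"
    using nat by (subst summable_on_reindex) (auto simp: o_def w_def)
  moreover have "w summable_on range (\<lambda>n. - int n)"
    using nat by (subst summable_on_reindex) (auto simp: o_def w_def inj_def)
  moreover have "range (\<lambda>n. - int n) \<union> range int = UNIV"
    by (auto intro: int_cases2)
  ultimately show ?thesis
    using summable_on_union[of w "range (\<lambda>n. - int n)" "range int"] by (simp add: w_def[abs_def])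
qed

section \<open>Sobolev spaces above the embedding threshold\<close>

lemma sobolevD:
  assumes "u \<in> sobolev r" "r > 1/2"
  shows "continuous_on A u" "u (x + 1) = u x" "sobolev_weighted r u summable_on UNIV"
  using assms by (auto simp: sobolev_def L2_circle_def intro: continuous_on_subset)

lemma sobolevI:
  assumes "continuous_on UNIV u" "\<And>x. u (x + 1) = u x" "sobolev_weighted r u summable_on UNIV"
  shows "u \<in> sobolev r"
proof -
  have "set_integrable lborel {0..1} (\<lambda>x. (u x)\<^sup>2)"
    by (intro borel_integrable_atLeastAtMost' continuous_intros continuous_on_subset[OF assms(1)]
        subset_UNIV)
  then show ?thesis
    using assms by (simp add: sobolev_def L2_circle_def borel_measurable_continuous_onI)
qed

lemma sobolev_weighted_nonneg: "sobolev_weighted r u n \<ge> 0"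
  by (simp add: sobolev_weighted_def)

lemma sobolev_norm_squared: "(sobolev_norm r u)\<^sup>2 = infsum (sobolev_weighted r u) UNIV"
  by (simp add: sobolev_norm_def infsum_nonneg sobolev_weighted_nonneg)

lemma sobolev_norm_nonneg: "sobolev_norm r u \<ge> 0"
  by (simp add: sobolev_norm_def infsum_nonneg sobolev_weighted_nonneg)

section \<open>Linear structure of the Sobolev classes\<close>

lemma fourier_coeff_linear:
  assumes "continuous_on UNIV u" "continuous_on UNIV v"
  shows "fourier_coeff (\<lambda>x. a * u x + b * v x) n = a * fourier_coeff u n + b * fourier_coeff v n"
proof -
  note cont = continuous_on_subset[OF assms(1) subset_UNIV] continuous_on_subset[OF assms(2) subset_UNIV]
  have int: "(\<lambda>x. of_real a * (of_real (u x) * trig (- n) x)) integrable_on {0..1}"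
    "(\<lambda>x. of_real b * (of_real (v x) * trig (- n) x)) integrable_on {0..1}"
    by (intro integrable_continuous_real continuous_intros cont)+
  have "fourier_coeff (\<lambda>x. a * u x + b * v x) n
      = integral {0..1} (\<lambda>x. of_real (a * u x + b * v x) * trig (- n) x)"
    by (intro fourier_coeff_eq_integral continuous_intros assms)
  also have "(\<lambda>x. of_real (a * u x + b * v x) * trig (- n) x)
      = (\<lambda>x. of_real a * (of_real (u x) * trig (- n) x) + of_real b * (of_real (v x) * trig (- n) x))"
    by (simp add: algebra_simps)
  also have "integral {0..1} \<dots> = a * fourier_coeff u n + b * fourier_coeff v n"
    by (subst integral_add[OF int]) (simp add: fourier_coeff_eq_integral assms)
  finally show ?thesis .
qed

text \<open>The bound (p + q)^2 \<le> 2 p^2 + 2 q^2 stands in for the triangle inequality. It holds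
  term by term, so it can be summed directly, and it is strong enough for membership and for limits
  equal to 0.\<close>

lemma sobolev_weighted_linear_le:
  assumes "continuous_on UNIV u" "continuous_on UNIV v"
  shows "sobolev_weighted r (\<lambda>x. a * u x + b * v x) n
       \<le> 2 * a\<^sup>2 * sobolev_weighted r u n + 2 * b\<^sup>2 * sobolev_weighted r v n"
proof -
  have "cmod (a * fourier_coeff u n + b * fourier_coeff v n)
      \<le> \<bar>a\<bar> * cmod (fourier_coeff u n) + \<bar>b\<bar> * cmod (fourier_coeff v n)" (is "_ \<le> ?p + ?q")
    by (rule norm_triangle_le) (simp add: norm_mult)
  then have "(cmod (a * fourier_coeff u n + b * fourier_coeff v n))\<^sup>2 \<le> (?p + ?q)\<^sup>2"
    by (rule power_mono) simp
  also have "\<dots> \<le> 2 * ?p\<^sup>2 + 2 * ?q\<^sup>2"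
    using sum_squares_ge_zero[of "?p - ?q" 0] by (simp add: power2_eq_square algebra_simps)
  finally have "(1 + (of_int n)\<^sup>2) powr r * (cmod (a * fourier_coeff u n + b * fourier_coeff v n))\<^sup>2
      \<le> (1 + (of_int n)\<^sup>2) powr r * (2 * ?p\<^sup>2 + 2 * ?q\<^sup>2)"
    by (rule mult_left_mono) simp
  then show ?thesis
    by (simp add: sobolev_weighted_def fourier_coeff_linear[OF assms] power_mult_distrib algebra_simps)
qed

lemma
  assumes r: "r > 1/2" and u: "u \<in> sobolev r" and v: "v \<in> sobolev r"
  shows sobolev_linear: "(\<lambda>x. a * u x + b * v x) \<in> sobolev r"
    and sobolev_norm_linear_le: "(sobolev_norm r (\<lambda>x. a * u x + b * v x))\<^sup>2
          \<le> 2 * a\<^sup>2 * (sobolev_norm r u)\<^sup>2 + 2 * b\<^sup>2 * (sobolev_norm r v)\<^sup>2"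
proof -
  note U = sobolevD[OF u r] and V = sobolevD[OF v r]
  have sum: "(\<lambda>n. 2 * a\<^sup>2 * sobolev_weighted r u n) summable_on UNIV"
    "(\<lambda>n. 2 * b\<^sup>2 * sobolev_weighted r v n) summable_on UNIV"
    by (intro summable_on_cmult_right U V)+
  have le: "sobolev_weighted r (\<lambda>x. a * u x + b * v x) n
       \<le> 2 * a\<^sup>2 * sobolev_weighted r u n + 2 * b\<^sup>2 * sobolev_weighted r v n" for n
    by (intro sobolev_weighted_linear_le U V)
  have *: "sobolev_weighted r (\<lambda>x. a * u x + b * v x) summable_on UNIV"
    by (rule summable_on_comparison_test[OF summable_on_add[OF sum]])
       (simp_all add: le sobolev_weighted_nonneg)
  show "(\<lambda>x. a * u x + b * v x) \<in> sobolev r"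
    by (intro sobolevI continuous_intros U V *) (simp add: U V)
  have "infsum (sobolev_weighted r (\<lambda>x. a * u x + b * v x)) UNIV
      \<le> infsum (\<lambda>n. 2 * a\<^sup>2 * sobolev_weighted r u n + 2 * b\<^sup>2 * sobolev_weighted r v n) UNIV"
    by (intro infsum_mono * summable_on_add sum le)
  also have "\<dots> = 2 * a\<^sup>2 * infsum (sobolev_weighted r u) UNIV + 2 * b\<^sup>2 * infsum (sobolev_weighted r v) UNIV"
    by (simp only: infsum_add[OF sum] infsum_cmult_right' )
  finally show "(sobolev_norm r (\<lambda>x. a * u x + b * v x))\<^sup>2
          \<le> 2 * a\<^sup>2 * (sobolev_norm r u)\<^sup>2 + 2 * b\<^sup>2 * (sobolev_norm r v)\<^sup>2"
    by (simp only: sobolev_norm_squared)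
qed

text \<open>The free parameter \<open>L\<close> replaces the Cauchy-Schwarz inequality: after summation it is set to
  the norm.\<close>

lemma le_weighted_square:
  fixes m r z L :: real
  assumes "L > 0" "m > 0"
  shows "z \<le> L / 2 * m powr (- r) + 1 / (2 * L) * (m powr r * z\<^sup>2)"
proof -
  define W where "W = m powr (r / 2)"
  have W: "W > 0"
    using assms by (simp add: W_def)
  have 1: "m powr r = W\<^sup>2"
    by (simp add: W_def power2_eq_square flip: powr_add)
  then have 2: "m powr (- r) = 1 / W\<^sup>2"
    by (simp add: powr_minus_divide)
  \<comment> \<open>Completing the square shows that the gap between the two sides is
    nonnegative.\<close>
  have "L / 2 * (1 / W\<^sup>2) + 1 / (2 * L) * (W\<^sup>2 * z\<^sup>2) - z = (L / W - W * z)\<^sup>2 / (2 * L)"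
    using W assms by (simp add: field_simps power2_eq_square)
  also have "\<dots> \<ge> 0"
    using assms by simp
  finally show ?thesis
    by (simp add: 1 2)
qed

lemma one_plus_square_pos: "1 + (x::real)\<^sup>2 > 0"
  by (rule add_pos_nonneg) auto

section \<open>Sobolev embedding into bounded functions\<close>

lemma cmod_fourier_coeff_le:
  assumes "L > 0"
  shows "cmod (fourier_coeff u n)
    \<le> L / 2 * (1 + (of_int n)\<^sup>2) powr (- r) + 1 / (2 * L) * sobolev_weighted r u n"
  unfolding sobolev_weighted_def by (rule le_weighted_square[OF assms one_plus_square_pos])

lemma summable_fourier_coeff:
  assumes r: "r > 1/2" and u: "u \<in> sobolev r"
  shows "(\<lambda>n. cmod (fourier_coeff u n)) summable_on UNIV"
proof (rule summable_on_comparison_test)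
  show "(\<lambda>n. 1 / 2 * (1 + (real_of_int n)\<^sup>2) powr (- r) + 1 / (2 * 1) * sobolev_weighted r u n) summable_on UNIV"
    by (intro summable_on_add summable_on_cmult_right summable_sobolev_weight[OF r] sobolevD[OF u r])
qed (use cmod_fourier_coeff_le[of 1 u _ r] in auto)

text \<open>By Fourier inversion the absolute value of u is at most the sum of the moduli of its
  coefficients, hence at most L/2 * K + N^2 / (2 L) with K the sum of the inverse weights and N the
  norm. The choice L = N gives (K + 1)/2 * N.\<close>

lemma sobolev_embedding:
  assumes r: "r > 1/2"
  obtains C where "C \<ge> 0" "\<And>u x. u \<in> sobolev r \<Longrightarrow> \<bar>u x\<bar> \<le> C * sobolev_norm r u"
proof
  define K where "K = infsum (\<lambda>n::int. (1 + (of_int n)\<^sup>2) powr (- r) :: real) UNIV"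
  show "(K + 1) / 2 \<ge> 0"
    by (simp add: K_def infsum_nonneg)
  fix u x assume u: "u \<in> sobolev r"
  define N where "N = sobolev_norm r u"
  have bound: "\<bar>u x\<bar> \<le> L / 2 * K + 1 / (2 * L) * N\<^sup>2" if "L > 0" for L
  proof -
    have sum: "(\<lambda>n. L / 2 * (1 + (real_of_int n)\<^sup>2) powr (- r)) summable_on UNIV"
      "(\<lambda>n. 1 / (2 * L) * sobolev_weighted r u n) summable_on UNIV"
      by (intro summable_on_cmult_right summable_sobolev_weight[OF r] sobolevD[OF u r])+
    have "\<bar>u x\<bar> = cmod (\<Sum>\<^sub>\<infinity>n. fourier_coeff u n * trig n x)"
      using fourier_inversion[OF sobolevD(1,2)[OF u r] summable_fourier_coeff[OF r u], of x]
      by (metis norm_of_real)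
    also have "\<dots> \<le> (\<Sum>\<^sub>\<infinity>n. cmod (fourier_coeff u n * trig n x))"
      by (rule norm_infsum_bound) (simp add: norm_mult summable_fourier_coeff[OF r u])
    also have "\<dots> = (\<Sum>\<^sub>\<infinity>n. cmod (fourier_coeff u n))"
      by (simp add: norm_mult)
    also have "\<dots> \<le> (\<Sum>\<^sub>\<infinity>n. L / 2 * (1 + (real_of_int n)\<^sup>2) powr (- r) + 1 / (2 * L) * sobolev_weighted r u n)"
      by (intro infsum_mono summable_fourier_coeff[OF r u] summable_on_add sum cmod_fourier_coeff_le that)
    also have "\<dots> = L / 2 * K + 1 / (2 * L) * N\<^sup>2"
      by (simp only: infsum_add[OF sum] infsum_cmult_right' K_def N_def sobolev_norm_squared)
    finally show ?thesis .
  qed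
  have "N \<ge> 0"
    by (simp add: N_def sobolev_norm_nonneg)
  show "\<bar>u x\<bar> \<le> (K + 1) / 2 * sobolev_norm r u"
  proof (cases "N = 0")
    case False
    then show ?thesis
      using bound[of N] \<open>N \<ge> 0\<close> by (simp add: field_simps power2_eq_square flip: N_def)
  next
    case True
    \<comment> \<open>The choice L = N is not admissible for N = 0; there the bound is L/2 * K, and
      L tends to 0.\<close>
    have "\<bar>u x\<bar> \<le> 0"
    proof (rule field_le_epsilon)
      fix e :: real assume "e > 0"
      have "K \<ge> 0"
        by (simp add: K_def infsum_nonneg)
      have "\<bar>u x\<bar> \<le> (e / (K + 1)) / 2 * K"
        using bound[of "e / (K + 1)"] True \<open>e > 0\<close> \<open>K \<ge> 0\<close> by simp
      also have "\<dots> \<le> 0 + e"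
        using \<open>e > 0\<close> \<open>K \<ge> 0\<close> by (simp add: field_simps)
      finally show "\<bar>u x\<bar> \<le> 0 + e" .
    qed
    with True show ?thesis
      by (simp add: N_def)
  qed
qed

text \<open>Only the coefficient at 0 can be nonzero. This places the initial point (1, 0) in every
  Sobolev class.\<close>

lemma sobolev_const: "(\<lambda>x. k) \<in> sobolev r"
proof (rule sobolevI)
  have "fourier_coeff (\<lambda>x. k) n = (if n = 0 then of_real k else 0)" for n
    by (simp add: fourier_coeff_eq_integral integral_trig[of "- n"])
  then have *: "sobolev_weighted r (\<lambda>x. k) n = 0" if "n \<notin> {0}" for n
    using that by (simp add: sobolev_weighted_def)
  show "sobolev_weighted r (\<lambda>x. k) summable_on UNIV"
    by (rule has_sum_imp_summable[OF has_sum_finite_neutralI[of "{0}"]]) (use * in auto)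
qed auto

section \<open>Differentiation lowers the Sobolev exponent by one\<close>

text \<open>The termwise derivative v of the Fourier series converges absolutely because s - 1 >
  1/2. Integrating v termwise returns the increments of u, so v is the derivative of u. Its
  coefficients carry a factor n, and n^2 \<le> 1 + n^2 absorbs it at the cost of one unit in the
  exponent.\<close>

lemma
  assumes s: "s > 3/2" and u: "u \<in> sobolev s"
  shows sobolev_has_deriv: "(u has_real_derivative deriv u x) (at x)"
    and sobolev_deriv: "deriv u \<in> sobolev (s - 1)"
proof -
  have s': "s > 1/2" "s - 1 > 1/2"
    using s by auto
  note U = sobolevD[OF u s'(1)]
  define b where "b n = 2 * pi * of_int n * \<i> * fourier_coeff u n" for n
  define v where "v x = (\<Sum>\<^sub>\<infinity>n. b n * trig n x)" for x
  define w where "w n = (1 + (real_of_int n)\<^sup>2) powr (s - 1) * (cmod (b n))\<^sup>2" for n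
  have w_le: "w n \<le> 4 * pi\<^sup>2 * sobolev_weighted s u n" for n
  proof -
    have "w n = 4 * pi\<^sup>2 * ((1 + (real_of_int n)\<^sup>2) powr (s - 1) * (real_of_int n)\<^sup>2 * (cmod (fourier_coeff u n))\<^sup>2)"
      by (simp add: w_def b_def norm_mult power_mult_distrib)
    also have "\<dots> \<le> 4 * pi\<^sup>2 * ((1 + (real_of_int n)\<^sup>2) powr (s - 1) * (1 + (real_of_int n)\<^sup>2) * (cmod (fourier_coeff u n))\<^sup>2)"
      by (intro mult_left_mono mult_right_mono) auto
    also have "(1 + (real_of_int n)\<^sup>2) powr (s - 1) * (1 + (real_of_int n)\<^sup>2) = (1 + (real_of_int n)\<^sup>2) powr s"
      using one_plus_square_pos[of "of_int n"] by (simp add: powr_diff)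
    finally show ?thesis
      by (simp add: sobolev_weighted_def)
  qed
  have sum_w: "w summable_on UNIV"
    by (rule summable_on_comparison_test[OF summable_on_cmult_right[OF U(3), of "4 * pi\<^sup>2"] w_le])
       (simp add: w_def)
  have sum_b: "(\<lambda>n. cmod (b n)) summable_on UNIV"
  proof (rule summable_on_comparison_test)
    show "(\<lambda>n. 1 / 2 * (1 + (real_of_int n)\<^sup>2) powr (- (s - 1)) + 1 / (2 * 1) * w n) summable_on UNIV"
      by (intro summable_on_add summable_on_cmult_right summable_sobolev_weight[OF s'(2)] sum_w)
    show "cmod (b n) \<le> 1 / 2 * (1 + (real_of_int n)\<^sup>2) powr (- (s - 1)) + 1 / (2 * 1) * w n" for n
      unfolding w_def by (intro le_weighted_square one_plus_square_pos) simp
  qed simp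
  have cv: "continuous_on A v" for A
    unfolding v_def[abs_def] by (rule continuous_on_trig_series[OF sum_b])
  have perv: "v (x + 1) = v x" for x
    by (simp add: v_def)
  have int_v: "integral {p..q} v = of_real (u q) - of_real (u p)" if "p \<le> q" for p q
  proof -
    have inv: "of_real (u x) = (\<Sum>\<^sub>\<infinity>n. fourier_coeff u n * trig n x)" for x
      by (rule fourier_inversion[OF U(1,2) summable_fourier_coeff[OF s'(1) u]])
    have hs: "((\<lambda>n. fourier_coeff u n * trig n x) has_sum of_real (u x)) UNIV" for x
      unfolding inv
      by (rule has_sum_infsum, rule abs_summable_summable)
         (simp add: norm_mult summable_fourier_coeff[OF s'(1) u])
    have "integral {p..q} (\<lambda>x. b n * trig n x * 1) = fourier_coeff u n * trig n q - fourier_coeff u n * trig n p" for n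
    proof -
      have "integral {p..q} (\<lambda>x. b n * trig n x * 1)
          = integral {p..q} (\<lambda>x. fourier_coeff u n * (2 * pi * of_int n * \<i> * trig n x))"
        by (simp add: b_def mult_ac)
      also have "\<dots> = fourier_coeff u n * (trig n q - trig n p)"
        by (intro integral_unique has_integral_mult_right has_integral_trig that)
      finally show ?thesis
        by (simp add: right_diff_distrib)
    qed
    with has_sum_integral_trig_series[OF sum_b, of p q "\<lambda>_. 1"]
    have "((\<lambda>n. fourier_coeff u n * trig n q - fourier_coeff u n * trig n p) has_sum integral {p..q} v) UNIV"
      by (simp add: v_def[abs_def])
    moreover have "((\<lambda>n. fourier_coeff u n * trig n q - fourier_coeff u n * trig n p) has_sum
        (of_real (u q) - of_real (u p))) UNIV"
      using has_sum_add[OF hs[of q] has_sum_uminusI[OF hs[of p]]] by simp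
    ultimately show ?thesis
      by (rule has_sum_unique)
  qed
  have D: "((\<lambda>x. complex_of_real (u x)) has_vector_derivative v x) (at x)" for x
  proof -
    \<comment> \<open>The interval from x - 1 to x + 1 has x in its interior, so the derivative
      within it is a full derivative.\<close>
    have "((\<lambda>y. integral {x - 1..y} v) has_vector_derivative v x) (at x within {x - 1..x + 1})"
      by (rule integral_has_vector_derivative[OF cv]) simp
    then have "((\<lambda>y. integral {x - 1..y} v) has_vector_derivative v x) (at x)"
      by (simp add: at_within_Icc_at)
    then have "((\<lambda>y. integral {x - 1..y} v + of_real (u (x - 1))) has_vector_derivative v x) (at x)"
      by (simp add: has_vector_derivative_add_const)
    then show ?thesis
      by (rule has_vector_derivative_transform_within_open[where S = "{x - 1<..}"])
         (simp_all add: int_v)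
  qed
  have Re: "(u has_real_derivative Re (v x)) (at x)" for x
    using bounded_linear.has_vector_derivative[OF bounded_linear_Re D[of x]]
    by (simp add: has_real_derivative_iff_has_vector_derivative)
  then have deriv: "deriv u x = Re (v x)" for x
    by (rule DERIV_imp_deriv)
  with Re show "(u has_real_derivative deriv u x) (at x)"
    by simp
  \<comment> \<open>The imaginary part of v is the derivative of the imaginary part of a real
    function, that is, of 0.\<close>
  have "((\<lambda>x. 0) has_vector_derivative Im (v x)) (at x)" for x
    using bounded_linear.has_vector_derivative[OF bounded_linear_Im D[of x]] by simp
  then have "Im (v x) = 0" for x
    using vector_derivative_unique_at has_vector_derivative_const by blast
  then have v: "of_real (deriv u x) = v x" for x
    by (simp add: deriv complex_eq_iff)
  have cderiv: "continuous_on UNIV (deriv u)"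
    using continuous_on_Re[OF cv] by (simp add: deriv[abs_def] cong: continuous_on_cong)
  have "fourier_coeff (deriv u) n = b n" for n
    using integral_trig_series[OF sum_b, of n]
    by (simp add: fourier_coeff_eq_integral[OF cderiv] v v_def)
  then have "sobolev_weighted (s - 1) (deriv u) = w"
    by (simp add: sobolev_weighted_def fun_eq_iff w_def)
  then show "deriv u \<in> sobolev (s - 1)"
    using sum_w by (intro sobolevI cderiv) (simp_all add: deriv perv)
qed

section \<open>Differentiable curves in Sobolev spaces\<close>

lemma sobolev2_linear:
  assumes "r > 1/2" "f \<in> sobolev2 r" "g \<in> sobolev2 r"
  shows "(\<lambda>x. a *\<^sub>R f x + b *\<^sub>R g x) \<in> sobolev2 r"
  using assms by (auto simp: sobolev2_def intro: sobolev_linear)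

lemma sobolev2_norm_linear_le:
  assumes r: "r > 1/2" and f: "f \<in> sobolev2 r" and g: "g \<in> sobolev2 r"
  shows "sobolev2_norm r (\<lambda>x. a *\<^sub>R f x + b *\<^sub>R g x)
       \<le> sqrt (2 * a\<^sup>2 * (sobolev2_norm r f)\<^sup>2 + 2 * b\<^sup>2 * (sobolev2_norm r g)\<^sup>2)"
proof -
  have "(\<lambda>x. fst (f x)) \<in> sobolev r" "(\<lambda>x. snd (f x)) \<in> sobolev r"
    "(\<lambda>x. fst (g x)) \<in> sobolev r" "(\<lambda>x. snd (g x)) \<in> sobolev r"
    using f g by (auto simp: sobolev2_def)
  from add_mono[OF sobolev_norm_linear_le[OF r this(1,3), of a b]
                   sobolev_norm_linear_le[OF r this(2,4), of a b]]
  show ?thesis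
    by (auto simp: sobolev2_norm_def algebra_simps)
qed

lemma tendsto_sobolev2_norm_linear:
  assumes "r > 1/2" "p \<in> sobolev2 r" "q \<in> sobolev2 r" "(a \<longlongrightarrow> 0) F" "(b \<longlongrightarrow> 0) F"
  shows "((\<lambda>h. sobolev2_norm r (\<lambda>x. a h *\<^sub>R p x + b h *\<^sub>R q x)) \<longlongrightarrow> 0) F"
proof (rule Lim_null_comparison)
  have "((\<lambda>h. sqrt (2 * (a h)\<^sup>2 * (sobolev2_norm r p)\<^sup>2 + 2 * (b h)\<^sup>2 * (sobolev2_norm r q)\<^sup>2))
      \<longlongrightarrow> sqrt (2 * 0\<^sup>2 * (sobolev2_norm r p)\<^sup>2 + 2 * 0\<^sup>2 * (sobolev2_norm r q)\<^sup>2)) F"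
    by (intro tendsto_intros assms)
  then show "((\<lambda>h. sqrt (2 * (a h)\<^sup>2 * (sobolev2_norm r p)\<^sup>2 + 2 * (b h)\<^sup>2 * (sobolev2_norm r q)\<^sup>2))
      \<longlongrightarrow> 0) F"
    by simp
  have "sobolev2_norm r f \<ge> 0" for f
    by (simp add: sobolev2_norm_def)
  then show "\<forall>\<^sub>F h in F. norm (sobolev2_norm r (\<lambda>x. a h *\<^sub>R p x + b h *\<^sub>R q x))
      \<le> sqrt (2 * (a h)\<^sup>2 * (sobolev2_norm r p)\<^sup>2 + 2 * (b h)\<^sup>2 * (sobolev2_norm r q)\<^sup>2)"
    using sobolev2_norm_linear_le[OF assms(1-3)] by (intro always_eventually) simp
qed

text \<open>The difference quotient minus the claimed derivative is again a combination of the fixed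
  functions p and q, with scalar coefficients that tend to 0.\<close>

lemma has_sobolev_derivative_linear:
  assumes "r > 1/2" "p \<in> sobolev2 r" "q \<in> sobolev2 r"
    and "(a has_real_derivative a') (at t)" "(b has_real_derivative b') (at t)"
  shows "has_sobolev_derivative r (\<lambda>t x. a t *\<^sub>R p x + b t *\<^sub>R q x) (\<lambda>x. a' *\<^sub>R p x + b' *\<^sub>R q x) t"
proof -
  have "((\<lambda>h. (a (t + h) - a t) / h - a') \<longlongrightarrow> a' - a') (at 0)"
    "((\<lambda>h. (b (t + h) - b t) / h - b') \<longlongrightarrow> b' - b') (at 0)"
    using assms(4,5) unfolding DERIV_def by (intro tendsto_diff tendsto_const; simp)+
  then have "((\<lambda>h. sobolev2_norm r (\<lambda>x. ((a (t + h) - a t) / h - a') *\<^sub>R p x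
                + ((b (t + h) - b t) / h - b') *\<^sub>R q x)) \<longlongrightarrow> 0) (at 0)"
    by (intro tendsto_sobolev2_norm_linear assms) simp_all
  moreover have "((a (t + h) *\<^sub>R P + b (t + h) *\<^sub>R Q) - (a t *\<^sub>R P + b t *\<^sub>R Q)) /\<^sub>R h - (a' *\<^sub>R P + b' *\<^sub>R Q)
      = ((a (t + h) - a t) / h - a') *\<^sub>R P + ((b (t + h) - b t) / h - b') *\<^sub>R Q" for h and P Q :: "real \<times> real"
    by (simp add: algebra_simps divide_inverse)
  ultimately show ?thesis
    using sobolev2_linear[OF assms(1-3)] by (simp add: has_sobolev_derivative_def)
qed

section \<open>Passage to bounded continuous functions\<close>

text \<open>\<open>Bcontfun\<close> is meaningful only on bounded continuous functions. The
  embedding ensures this for elements of \<open>sobolev2 r\<close> and makes the inclusion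
  continuous.\<close>

lemma sobolev2_bcontfun:
  assumes r: "r > 1/2"
  obtains C where "\<And>g. g \<in> sobolev2 r \<Longrightarrow> apply_bcontfun (Bcontfun g) = g"
    and "\<And>g. g \<in> sobolev2 r \<Longrightarrow> norm (Bcontfun g) \<le> C * sobolev2_norm r g"
proof -
  obtain C where C: "C \<ge> 0" "\<And>u x. u \<in> sobolev r \<Longrightarrow> \<bar>u x\<bar> \<le> C * sobolev_norm r u"
    using sobolev_embedding[OF r] by blast
  have bound: "norm (g x) \<le> C * sobolev2_norm r g" if "g \<in> sobolev2 r" for g x
  proof -
    have 1: "\<bar>fst (g x)\<bar> \<le> C * sobolev_norm r (\<lambda>x. fst (g x))"
      and 2: "\<bar>snd (g x)\<bar> \<le> C * sobolev_norm r (\<lambda>x. snd (g x))"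
      using that by (auto intro!: C(2) simp: sobolev2_def)
    have "norm (g x) = sqrt (\<bar>fst (g x)\<bar>\<^sup>2 + \<bar>snd (g x)\<bar>\<^sup>2)"
      by (simp add: norm_prod_def)
    also have "\<dots> \<le> sqrt ((C * sobolev_norm r (\<lambda>x. fst (g x)))\<^sup>2 + (C * sobolev_norm r (\<lambda>x. snd (g x)))\<^sup>2)"
      using 1 2 by (intro real_sqrt_le_mono add_mono power_mono) auto
    also have "\<dots> = C * sobolev2_norm r g"
      using C(1) by (simp add: sobolev2_norm_def power_mult_distrib real_sqrt_mult flip: distrib_left)
    finally show ?thesis .
  qed
  have inv: "apply_bcontfun (Bcontfun g) = g" if "g \<in> sobolev2 r" for g
  proof (rule Bcontfun_inverse, rule bcontfun_normI[OF _ bound[OF that]])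
    have "continuous_on UNIV (\<lambda>x. (fst (g x), snd (g x)))"
      using that by (intro continuous_on_Pair) (auto simp: sobolev2_def intro: sobolevD(1)[OF _ r])
    then show "continuous_on UNIV g"
      by simp
  qed
  show thesis
    by (rule that[of C]) (auto simp: inv bound intro!: norm_bound)
qed

text \<open>A continuous linear inclusion preserves derivatives. Openness of J is used because
  \<open>f (t + h)\<close> is known to lie in \<open>sobolev2 r\<close> only for t + h in J.\<close>

lemma has_vector_derivative_Bcontfun:
  assumes r: "r > 1/2" and J: "open J" "t \<in> J" "\<And>\<tau>. \<tau> \<in> J \<Longrightarrow> f \<tau> \<in> sobolev2 r"
    and f: "has_sobolev_derivative r f v t"
  shows "((\<lambda>\<tau>. Bcontfun (f \<tau>)) has_vector_derivative Bcontfun v) (at t)"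
proof -
  obtain C where C: "\<And>g. g \<in> sobolev2 r \<Longrightarrow> apply_bcontfun (Bcontfun g) = g"
      "\<And>g. g \<in> sobolev2 r \<Longrightarrow> norm (Bcontfun g) \<le> C * sobolev2_norm r g"
    using sobolev2_bcontfun[OF r] by blast
  have v: "v \<in> sobolev2 r"
    and lim: "((\<lambda>h. sobolev2_norm r (\<lambda>x. (f (t + h) x - f t x) /\<^sub>R h - v x)) \<longlongrightarrow> 0) (at 0)"
    using f by (auto simp: has_sobolev_derivative_def)
  have bound: "norm (Bcontfun (f (t + h)) - Bcontfun (f t) - h *\<^sub>R Bcontfun v) / norm h
      \<le> C * sobolev2_norm r (\<lambda>x. (f (t + h) x - f t x) /\<^sub>R h - v x)"
    if h: "t + h \<in> J" "h \<noteq> 0" for h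
  proof -
    note ft = J(3)[OF J(2)] J(3)[OF h(1)]
    define q where "q x = (f (t + h) x - f t x) /\<^sub>R h - v x" for x
    have "(\<lambda>x. 1 *\<^sub>R ((1 / h) *\<^sub>R f (t + h) x + (- 1 / h) *\<^sub>R f t x) + (- 1) *\<^sub>R v x) \<in> sobolev2 r"
      by (intro sobolev2_linear r ft v)
    moreover have "(\<lambda>x. 1 *\<^sub>R ((1 / h) *\<^sub>R f (t + h) x + (- 1 / h) *\<^sub>R f t x) + (- 1) *\<^sub>R v x) = q"
      by (simp add: q_def fun_eq_iff algebra_simps divide_inverse)
    ultimately have q: "q \<in> sobolev2 r"
      by simp
    have "Bcontfun (f (t + h)) - Bcontfun (f t) - h *\<^sub>R Bcontfun v = h *\<^sub>R Bcontfun q"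
      by (rule bcontfun_eqI) (simp add: C(1) ft v q, simp add: q_def algebra_simps h)
    then show ?thesis
      using C(2)[OF q] h by (simp add: q_def[abs_def])
  qed
  have "\<forall>\<^sub>F h in at 0. t + h \<in> J"
  proof -
    have "((\<lambda>h. t + h) \<longlongrightarrow> t) (at 0)"
      by (rule tendsto_eq_intros | simp)+
    then show ?thesis
      using J by (auto dest: topological_tendstoD)
  qed
  then have "\<forall>\<^sub>F h in at 0. norm (norm (Bcontfun (f (t + h)) - Bcontfun (f t) - h *\<^sub>R Bcontfun v) / norm h)
      \<le> C * sobolev2_norm r (\<lambda>x. (f (t + h) x - f t x) /\<^sub>R h - v x)"
    using eventually_neq_at_within[of 0]
    by eventually_elim (use bound in simp)
  then have "((\<lambda>h. norm (Bcontfun (f (t + h)) - Bcontfun (f t) - h *\<^sub>R Bcontfun v) / norm h) \<longlongrightarrow> 0) (at 0)"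
    by (rule Lim_null_comparison) (rule tendsto_mult_right_zero[OF lim])
  then show ?thesis
    unfolding has_vector_derivative_def has_derivative_at
    by (simp add: bounded_linear_scaleR_left)
qed

section \<open>The indefinite scalar product on continuous functions\<close>

lemma indef_inner_eq_integral:
  assumes "continuous_on UNIV X" "continuous_on UNIV Y"
  shows "indef_inner X Y = integral {0..1} (\<lambda>x. fst (X x) * fst (Y x) - snd (X x) * snd (Y x))"
  unfolding indef_inner_def
  by (intro set_borel_integral_eq_integral borel_integrable_atLeastAtMost' continuous_intros
      continuous_on_subset[OF assms(1)] continuous_on_subset[OF assms(2)] subset_UNIV)

lemma indef_inner_commute: "indef_inner X Y = indef_inner Y X"
  by (simp add: indef_inner_def mult.commute)

text \<open>This supplies the product rule for scalar products of curves. Each of the two products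
  in the integrand is bounded by the product of the sup norms, whence the constant 2.\<close>

lemma bounded_bilinear_indef_inner:
  "bounded_bilinear (\<lambda>X Y. indef_inner (apply_bcontfun X) (apply_bcontfun Y))"
    (is "bounded_bilinear ?B")
proof
  have cont: "continuous_on S (\<lambda>x. fst (apply_bcontfun X x) * fst (apply_bcontfun Y x)
      - snd (apply_bcontfun X x) * snd (apply_bcontfun Y x))" for S :: "real set" and X Y :: "real \<Rightarrow>\<^sub>C (real \<times> real)"
    by (intro continuous_intros) auto
  have B: "((\<lambda>x. fst (apply_bcontfun X x) * fst (apply_bcontfun Y x)
      - snd (apply_bcontfun X x) * snd (apply_bcontfun Y x)) has_integral ?B X Y) {0..1}" for X Y
    by (subst indef_inner_eq_integral) (auto intro!: integrable_integral integrable_continuous_real cont)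
  note eq = has_integral_unique[OF B]
  show add: "?B (X + X') Y = ?B X Y + ?B X' Y" for X X' Y
    by (rule eq) (use has_integral_add[OF B[of X Y] B[of X' Y]] in \<open>simp add: algebra_simps\<close>)
  show scale: "?B (a *\<^sub>R X) Y = a *\<^sub>R ?B X Y" for a X Y
    by (rule eq) (use has_integral_mult_right[OF B[of X Y], of a] in \<open>simp add: algebra_simps\<close>)
  show "?B X (Y + Y') = ?B X Y + ?B X Y'" for X Y Y'
    using add[of Y Y' X] by (simp add: indef_inner_commute)
  show "?B X (a *\<^sub>R Y) = a *\<^sub>R ?B X Y" for a X Y
    using scale[of a Y X] by (simp add: indef_inner_commute)
  have "norm (?B X Y) \<le> norm X * norm Y * 2" for X Y
  proof -
    have le: "\<bar>fst (apply_bcontfun X x)\<bar> \<le> norm X" "\<bar>snd (apply_bcontfun X x)\<bar> \<le> norm X" for X x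
      using norm_fst_le[of "fst (apply_bcontfun X x)" "snd (apply_bcontfun X x)"]
        norm_snd_le[of "snd (apply_bcontfun X x)" "fst (apply_bcontfun X x)"] norm_bounded[of X x]
      by simp_all
    have "norm (?B X Y) \<le> norm X * norm Y * 2 * (1 - 0)"
      unfolding indef_inner_eq_integral[OF continuous_on_apply_bcontfun continuous_on_apply_bcontfun]
    proof (rule integral_bound)
      fix x
      have "\<bar>fst (apply_bcontfun X x)\<bar> * \<bar>fst (apply_bcontfun Y x)\<bar> \<le> norm X * norm Y"
        "\<bar>snd (apply_bcontfun X x)\<bar> * \<bar>snd (apply_bcontfun Y x)\<bar> \<le> norm X * norm Y"
        by (intro mult_mono le; simp)+
      then show "norm (fst (apply_bcontfun X x) * fst (apply_bcontfun Y x)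
          - snd (apply_bcontfun X x) * snd (apply_bcontfun Y x)) \<le> norm X * norm Y * 2"
        unfolding real_norm_def abs_mult[symmetric] by linarith
    qed (auto intro: cont)
    then show ?thesis
      by simp
  qed
  then show "\<exists>K. \<forall>X Y. norm (?B X Y) \<le> norm X * norm Y * K"
    by blast
qed

section \<open>Uniqueness for a linear second-order equation\<close>

text \<open>\<open>A\<close> and \<open>B\<close> are the scalar fundamental solutions. Keeping them
  abstract lets one argument serve all three signs of c.\<close>

lemma linear_ode2_unique:
  fixes F V :: "real \<Rightarrow> 'a::real_normed_vector"
  assumes "convex J" "0 \<in> J" "t \<in> J"
    and F: "\<And>t. t \<in> J \<Longrightarrow> (F has_vector_derivative V t) (at t)"
    and V: "\<And>t. t \<in> J \<Longrightarrow> (V has_vector_derivative - c *\<^sub>R F t) (at t)"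
    and A: "\<And>t. (A has_real_derivative - c * B t) (at t)"
    and B: "\<And>t. (B has_real_derivative A t) (at t)"
    and AB: "\<And>t. (A t)\<^sup>2 + c * (B t)\<^sup>2 = 1" "A 0 = 1" "B 0 = 0"
  shows "F t = A t *\<^sub>R F 0 + B t *\<^sub>R V 0"
proof -
  text \<open>The Wronskians of the solution with \<open>A\<close> and with \<open>B\<close> are constant.\<close>
  have const: "W t = W 0"
    if W: "\<And>t. t \<in> J \<Longrightarrow> (W has_vector_derivative 0) (at t)" for W :: "real \<Rightarrow> 'a"
  proof -
    have "(W has_derivative (\<lambda>h. 0)) (at t within J)" if "t \<in> J" for t
      using W[OF that]
      by (simp add: has_vector_derivative_def has_derivative_at_withinI)
    then obtain k where "\<forall>t\<in>J. W t = k"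
      using has_derivative_zero_constant[OF \<open>convex J\<close>, of W] by blast
    then show ?thesis
      using assms(2,3) by simp
  qed
  have "A t *\<^sub>R V t + (c * B t) *\<^sub>R F t = A 0 *\<^sub>R V 0 + (c * B 0) *\<^sub>R F 0"
  proof (rule const)
    fix t assume t: "t \<in> J"
    have "((\<lambda>t. c * B t) has_real_derivative c * A t) (at t)"
      by (rule DERIV_cmult[OF B])
    from has_vector_derivative_add[OF has_vector_derivative_scaleR[OF A V[OF t]]
        has_vector_derivative_scaleR[OF this F[OF t]]]
    show "((\<lambda>t. A t *\<^sub>R V t + (c * B t) *\<^sub>R F t) has_vector_derivative 0) (at t)"
      by (simp add: algebra_simps)
  qed
  moreover have "A t *\<^sub>R F t - B t *\<^sub>R V t = A 0 *\<^sub>R F 0 - B 0 *\<^sub>R V 0"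
  proof (rule const)
    fix t assume t: "t \<in> J"
    from has_vector_derivative_diff[OF has_vector_derivative_scaleR[OF A F[OF t]]
        has_vector_derivative_scaleR[OF B V[OF t]]]
    show "((\<lambda>t. A t *\<^sub>R F t - B t *\<^sub>R V t) has_vector_derivative 0) (at t)"
      by (simp add: algebra_simps)
  qed
  \<comment> \<open>The conserved quantities are V 0 and F 0. They form a linear system for F t and
    V t whose determinant is A^2 + c B^2 = 1, and it is solved for F t.\<close>
  ultimately have "A t *\<^sub>R F 0 + B t *\<^sub>R V 0
      = A t *\<^sub>R (A t *\<^sub>R F t - B t *\<^sub>R V t) + B t *\<^sub>R (A t *\<^sub>R V t + (c * B t) *\<^sub>R F t)"
    by (simp add: AB)
  also have "\<dots> = ((A t)\<^sup>2 + c * (B t)\<^sup>2) *\<^sub>R F t"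
    by (simp add: algebra_simps power2_eq_square)
  finally show ?thesis
    by (simp add: AB)
qed

section \<open>Geodesics on the pseudosphere\<close>

text \<open>This is the uniqueness half. The interval J is arbitrary, so that geodesics defined only
  near time 0 are covered too.\<close>

lemma geodesic_from_eq:
  assumes r: "r > 1/2" and J: "open J" "is_interval J" "0 \<in> J" "t \<in> J"
    and f: "geodesic_from r J p w f" and c: "c = indef_inner w w"
    and A: "\<And>t. (A has_real_derivative - c * B t) (at t)"
    and B: "\<And>t. (B has_real_derivative A t) (at t)"
    and AB: "\<And>t. (A t)\<^sup>2 + c * (B t)\<^sup>2 = 1" "A 0 = 1" "B 0 = 0"
  shows "f t = (\<lambda>x. A t *\<^sub>R p x + B t *\<^sub>R w x)"
proof -
  obtain v a where va: "C2_sobolev_curve r J f v a"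
      "\<And>t. t \<in> J \<Longrightarrow> f t \<in> sobolev_pseudosphere r"
      "\<And>t. t \<in> J \<Longrightarrow> tangential_part (f t) (a t) = (\<lambda>x. 0)"
    and f0: "f 0 = p" "has_sobolev_derivative r f w 0"
    using f by (auto simp: geodesic_from_def geodesic_def)
  have df: "has_sobolev_derivative r f (v t) t" and dv: "has_sobolev_derivative r v (a t) t"
    and f_in: "f t \<in> sobolev2 r" if "t \<in> J" for t
    using va(1) that by (auto simp: C2_sobolev_curve_def)
  have v_in: "v t \<in> sobolev2 r" and a_in: "a t \<in> sobolev2 r" if "t \<in> J" for t
    using df[OF that] dv[OF that] by (auto simp: has_sobolev_derivative_def)
  have w_in: "w \<in> sobolev2 r"
    using f0(2) by (simp add: has_sobolev_derivative_def)
  have inv: "apply_bcontfun (Bcontfun g) = g" if "g \<in> sobolev2 r" for g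
    using sobolev2_bcontfun[OF r] that by metis
  define F where "F t = Bcontfun (f t)" for t
  define V where "V t = Bcontfun (v t)" for t
  define Q where "Q X Y = indef_inner (apply_bcontfun X) (apply_bcontfun Y)" for X Y
  interpret Q: bounded_bilinear Q
    unfolding Q_def[abs_def] by (rule bounded_bilinear_indef_inner)
  have Qc: "Q X Y = Q Y X" for X Y
    by (simp add: Q_def indef_inner_commute)
  have dF: "(F has_vector_derivative V t) (at t)" if "t \<in> J" for t
    unfolding F_def V_def
    by (rule has_vector_derivative_Bcontfun[OF r J(1) that f_in df[OF that]])
  have dV: "(V has_vector_derivative Bcontfun (a t)) (at t)" if "t \<in> J" for t
    unfolding V_def
    by (rule has_vector_derivative_Bcontfun[OF r J(1) that v_in dv[OF that]])
  have QFF: "Q (F t) (F t) = 1" if "t \<in> J" for t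
    using va(2)[OF that]
    by (simp add: Q_def F_def inv f_in that sobolev_pseudosphere_def pseudosphere_def indef_inner_def
        power2_eq_square)
  have zero: "D = 0" if "(h has_vector_derivative D) (at t)" "\<And>t. t \<in> J \<Longrightarrow> h t = k" "t \<in> J"
    for h :: "real \<Rightarrow> real" and D k t
    using has_vector_derivative_transform_within_open[OF that(1) J(1) that(3) that(2)]
      has_vector_derivative_const vector_derivative_unique_at by blast
  have QFV: "Q (F t) (V t) = 0" if "t \<in> J" for t
    using zero[OF Q.has_vector_derivative[OF dF dF, OF that that] QFF that] by (simp add: Qc)
  have QFA: "Q (F t) (Bcontfun (a t)) + Q (V t) (V t) = 0" if "t \<in> J" for t
    using zero[OF Q.has_vector_derivative[OF dF dV, OF that that] QFV that] by simp
  have acc: "Bcontfun (a t) = - Q (V t) (V t) *\<^sub>R F t" if "t \<in> J" for t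
  proof (rule bcontfun_eqI)
    fix x
    have ff: "indef_inner (f t) (f t) = 1"
      using QFF[OF that] by (simp add: Q_def F_def inv f_in that)
    have af: "indef_inner (a t) (f t) = - Q (V t) (V t)"
      using QFA[OF that] by (simp add: Q_def F_def inv f_in a_in that indef_inner_commute)
    have "a t x - (indef_inner (a t) (f t) / indef_inner (f t) (f t)) *\<^sub>R f t x = 0"
      using fun_cong[OF va(3)[OF that], of x] by (simp only: tangential_part_def)
    then have "a t x = - Q (V t) (V t) *\<^sub>R f t x"
      by (simp only: ff af div_by_1 right_minus_eq)
    then show "apply_bcontfun (Bcontfun (a t)) x = apply_bcontfun (- Q (V t) (V t) *\<^sub>R F t) x"
      by (simp add: F_def inv a_in f_in that)
  qed
  \<comment> \<open>Both are the derivative of F at 0, and derivatives are unique.\<close>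
  have "V 0 = Bcontfun w"
    using vector_derivative_unique_at[OF dF[OF J(3)], of "Bcontfun w"]
      has_vector_derivative_Bcontfun[OF r J(1,3) f_in f0(2)] by (simp add: F_def[abs_def])
  have QVV: "Q (V t) (V t) = c" if "t \<in> J" for t
  proof -
    \<comment> \<open>The acceleration is a multiple of F, and F is orthogonal to V, so the product
      rule gives 0.\<close>
    have "((\<lambda>t. Q (V t) (V t)) has_derivative (\<lambda>h. 0)) (at t within J)" if "t \<in> J" for t
      using Q.has_vector_derivative[OF dV dV, OF that that] QFV[OF that]
      by (auto simp: acc[OF that] Qc Q.scaleR_left Q.scaleR_right Q.minus_left Q.minus_right
          has_vector_derivative_def intro: has_derivative_at_withinI)
    then obtain k where "\<And>t. t \<in> J \<Longrightarrow> Q (V t) (V t) = k"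
      using has_derivative_zero_constant[OF is_interval_convex[OF J(2)]] by metis
    then have "Q (V t) (V t) = Q (V 0) (V 0)"
      using that J(3) by simp
    then show ?thesis
      by (simp add: \<open>V 0 = Bcontfun w\<close> Q_def inv w_in c)
  qed
  have "(V has_vector_derivative - c *\<^sub>R F t) (at t)" if "t \<in> J" for t
    using dV[OF that] by (simp add: acc QVV that)
  from linear_ode2_unique[OF is_interval_convex[OF J(2)] J(3,4) dF this A B AB]
  have "F t = A t *\<^sub>R F 0 + B t *\<^sub>R V 0" .
  then have "apply_bcontfun (F t) = apply_bcontfun (A t *\<^sub>R F 0 + B t *\<^sub>R V 0)"
    by simp
  then show ?thesis
    using f_in[OF J(4)] f_in[OF J(3)] w_in
    by (simp add: \<open>V 0 = Bcontfun w\<close> fun_eq_iff) (simp add: F_def inv f0(1))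
qed

text \<open>This is the existence half. Orthogonality of p and w gives <<f, f>> = A^2 + c B^2 = 1,
  so the curve stays on the pseudosphere. Its acceleration is -c f, which is purely normal.\<close>

lemma geodesic_from_linear:
  assumes r: "r > 1/2" and p: "p \<in> sobolev2 r" and w: "w \<in> sobolev2 r"
    and pp: "indef_inner p p = 1" and pw: "indef_inner p w = 0" and c: "c = indef_inner w w"
    and A: "\<And>t. (A has_real_derivative - c * B t) (at t)"
    and B: "\<And>t. (B has_real_derivative A t) (at t)"
    and AB: "\<And>t. (A t)\<^sup>2 + c * (B t)\<^sup>2 = 1" "A 0 = 1" "B 0 = 0"
  shows "geodesic_from r UNIV p w (\<lambda>t x. A t *\<^sub>R p x + B t *\<^sub>R w x)"
proof -
  define f where "f t x = A t *\<^sub>R p x + B t *\<^sub>R w x" for t x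
  define v where "v t x = (- c * B t) *\<^sub>R p x + A t *\<^sub>R w x" for t x
  define a where "a t x = (- c * A t) *\<^sub>R p x + (- c * B t) *\<^sub>R w x" for t x
  have lin: "(\<lambda>x. \<alpha> *\<^sub>R p x + \<beta> *\<^sub>R w x) \<in> sobolev2 r" for \<alpha> \<beta>
    by (rule sobolev2_linear[OF r p w])
  have f_in: "f t \<in> sobolev2 r" for t
    unfolding f_def[abs_def] by (rule lin)
  have df: "has_sobolev_derivative r f (v t) t" for t
    unfolding f_def[abs_def] v_def[abs_def]
    by (rule has_sobolev_derivative_linear[OF r p w A B])
  have dv: "has_sobolev_derivative r v (a t) t" for t
    unfolding v_def[abs_def] a_def[abs_def]
    by (rule has_sobolev_derivative_linear[OF r p w DERIV_cmult[OF B] A])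
  have ca: "((\<lambda>\<tau>. sobolev2_norm r (\<lambda>x. a \<tau> x - a t x)) \<longlongrightarrow> 0) (at t)" for t
  proof -
    have "((\<lambda>\<tau>. - c * A \<tau> - - c * A t) \<longlongrightarrow> - c * A t - - c * A t) (at t)"
      "((\<lambda>\<tau>. - c * B \<tau> - - c * B t) \<longlongrightarrow> - c * B t - - c * B t) (at t)"
      by (intro tendsto_intros DERIV_isCont[OF A, unfolded isCont_def]
          DERIV_isCont[OF B, unfolded isCont_def])+
    then have "((\<lambda>\<tau>. sobolev2_norm r (\<lambda>x. (- c * A \<tau> - - c * A t) *\<^sub>R p x
        + (- c * B \<tau> - - c * B t) *\<^sub>R w x)) \<longlongrightarrow> 0) (at t)"
      by (intro tendsto_sobolev2_norm_linear r p w) simp_all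
    then show ?thesis
      by (simp add: a_def algebra_simps)
  qed
  have inv: "apply_bcontfun (Bcontfun g) = g" if "g \<in> sobolev2 r" for g
    using sobolev2_bcontfun[OF r] that by metis
  have ff: "indef_inner (f t) (f t) = 1" for t
  proof -
    \<comment> \<open>Bilinearity is available on bounded continuous functions, so the square of the
      combination is expanded there and then read back for p and w.\<close>
    interpret Q: bounded_bilinear "\<lambda>X Y. indef_inner (apply_bcontfun X) (apply_bcontfun Y)"
      by (rule bounded_bilinear_indef_inner)
    have expand: "indef_inner (apply_bcontfun (\<alpha> *\<^sub>R X + \<beta> *\<^sub>R Y)) (apply_bcontfun (\<alpha> *\<^sub>R X + \<beta> *\<^sub>R Y))
        = \<alpha>\<^sup>2 * indef_inner (apply_bcontfun X) (apply_bcontfun X)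
          + 2 * \<alpha> * \<beta> * indef_inner (apply_bcontfun X) (apply_bcontfun Y)
          + \<beta>\<^sup>2 * indef_inner (apply_bcontfun Y) (apply_bcontfun Y)" for \<alpha> \<beta> X Y
      by (simp only: Q.add_left Q.add_right Q.scaleR_left Q.scaleR_right
          indef_inner_commute[of "apply_bcontfun Y" "apply_bcontfun X"])
         (simp add: algebra_simps power2_eq_square)
    have "f t = apply_bcontfun (A t *\<^sub>R Bcontfun p + B t *\<^sub>R Bcontfun w)"
      by (simp add: f_def fun_eq_iff inv p w)
    then have "indef_inner (f t) (f t) = (A t)\<^sup>2 * indef_inner p p + 2 * A t * B t * indef_inner p w
        + (B t)\<^sup>2 * indef_inner w w"
      by (simp only: expand inv p w)
    then show ?thesis
      using AB(1)[of t] by (simp add: pp pw c[symmetric] mult.commute)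
  qed
  have tan: "tangential_part (f t) (a t) = (\<lambda>x. 0)" for t
  proof -
    have a: "a t = (\<lambda>x. (- c) *\<^sub>R f t x)"
      by (simp add: a_def f_def fun_eq_iff algebra_simps)
    have "indef_inner (\<lambda>x. k *\<^sub>R X x) Y = k * indef_inner X Y" for k X Y
      by (simp add: indef_inner_def flip: set_integral_mult_right) (simp add: algebra_simps)
    then show ?thesis
      by (simp only: tangential_part_def a ff) simp
  qed
  have "f t \<in> sobolev_pseudosphere r" for t
    using f_in[of t] ff[of t]
    by (simp add: sobolev_pseudosphere_def pseudosphere_def sobolev2_def sobolev_def indef_inner_def
        power2_eq_square)
  then have "geodesic r UNIV f"
    unfolding geodesic_def C2_sobolev_curve_def using f_in df dv ca tan by blast
  moreover have "f 0 = p" "v 0 = w"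
    by (simp_all add: f_def v_def fun_eq_iff AB)
  ultimately have "geodesic_from r UNIV p w f"
    using df[of 0] by (simp add: geodesic_from_def)
  then show ?thesis
    by (simp add: f_def[abs_def])
qed

text \<open>The solutions of \<open>y'' = - c y\<close> with initial data \<open>(1, 0)\<close> and \<open>(0, 1)\<close>.\<close>

definition gcos :: "real \<Rightarrow> real \<Rightarrow> real" where
  "gcos c t = (if c > 0 then cos (sqrt c * t) else if c = 0 then 1 else cosh (sqrt \<bar>c\<bar> * t))"

definition gsin :: "real \<Rightarrow> real \<Rightarrow> real" where
  "gsin c t = (if c > 0 then sin (sqrt c * t) / sqrt c else if c = 0 then t
               else sinh (sqrt \<bar>c\<bar> * t) / sqrt \<bar>c\<bar>)"

lemma gcos_gsin_0: "gcos c 0 = 1" "gsin c 0 = 0"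
  by (auto simp: gcos_def gsin_def)

lemma DERIV_gcos: "(gcos c has_real_derivative - c * gsin c t) (at t)"
proof -
  define k where "k = sqrt \<bar>c\<bar>"
  have k: "k * k = \<bar>c\<bar>"
    by (simp add: k_def)
  consider "c > 0" | "c = 0" | "c < 0" by linarith
  then show ?thesis
  proof cases
    case 1
    then have "k > 0" "c = k * k" "sqrt c = k"
      by (simp_all add: k k_def)
    then have "((\<lambda>t. cos (sqrt c * t)) has_real_derivative - c * (sin (sqrt c * t) / sqrt c)) (at t)"
      by (auto intro!: derivative_eq_intros)
    with 1 show ?thesis
      by (simp add: gcos_def[abs_def] gsin_def)
  next
    case 3
    then have "k > 0" "c = - (k * k)"
      by (simp_all add: k) (simp add: k_def)
    then have "((\<lambda>t. cosh (k * t)) has_real_derivative - c * (sinh (k * t) / k)) (at t)"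
      by (auto intro!: derivative_eq_intros)
    with 3 show ?thesis
      by (simp add: gcos_def[abs_def] gsin_def k_def)
  qed (simp add: gcos_def[abs_def])
qed

lemma DERIV_gsin: "(gsin c has_real_derivative gcos c t) (at t)"
proof -
  have "((\<lambda>t. sin (k * t) / k) has_real_derivative cos (k * t)) (at t)"
    "((\<lambda>t. sinh (k * t) / k) has_real_derivative cosh (k * t)) (at t)" if "k > 0" for k
    using that by (auto intro!: derivative_eq_intros)
  from this[of "sqrt \<bar>c\<bar>"] show ?thesis
    by (cases c "0 :: real" rule: linorder_cases) (simp_all add: gcos_def gsin_def[abs_def])
qed

text \<open>For c > 0 this is the Pythagorean identity. For c < 0 the quotient of c by its absolute
  value is -1, which gives the hyperbolic identity.\<close>

lemma gcos_gsin_squared: "(gcos c t)\<^sup>2 + c * (gsin c t)\<^sup>2 = 1"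
proof -
  consider "c > 0" | "c = 0" | "c < 0" by linarith
  then show ?thesis
    by cases (simp_all add: gcos_def gsin_def power_divide cosh_square_eq)
qed

theorem theorem3p2:
  fixes s c :: real and u0 \<rho>0 :: "real \<Rightarrow> real" and w :: "real \<Rightarrow> real \<times> real"
  assumes "s > 5/2"
    and "u0 \<in> sobolev0 s"
    and "\<rho>0 \<in> sobolev (s - 1)"
    and "w = (\<lambda>x. (1/2) *\<^sub>R (deriv u0 x, \<rho>0 x))"
    and "c = indef_inner w w"
  shows "c = 1/4 * (LBINT x:{0..1}. (deriv u0 x)\<^sup>2 - (\<rho>0 x)\<^sup>2) \<and>
    (\<exists>!f. geodesic_from (s - 1) UNIV (\<lambda>x. (1, 0)) w f) \<and>
    (\<forall>J f. open J \<and> is_interval J \<and> 0 \<in> J \<and> geodesic_from (s - 1) J (\<lambda>x. (1, 0)) w f \<longrightarrow>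
      (\<forall>t\<in>J.
        (c > 0 \<longrightarrow> f t = (\<lambda>x. (cos (sqrt c * t) + deriv u0 x / (2 * sqrt c) * sin (sqrt c * t),
                              \<rho>0 x / (2 * sqrt c) * sin (sqrt c * t)))) \<and>
        (c = 0 \<longrightarrow> f t = (\<lambda>x. (deriv u0 x / 2 * t + 1, \<rho>0 x / 2 * t))) \<and>
        (c < 0 \<longrightarrow> f t = (\<lambda>x. (cosh (sqrt \<bar>c\<bar> * t) + deriv u0 x / (2 * sqrt \<bar>c\<bar>) * sinh (sqrt \<bar>c\<bar> * t),
                              \<rho>0 x / (2 * sqrt \<bar>c\<bar>) * sinh (sqrt \<bar>c\<bar> * t))))))"
proof -
  define p :: "real \<Rightarrow> real \<times> real" where "p = (\<lambda>x. (1, 0))"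
  have r: "s - 1 > 1/2" "s > 3/2" "s > 1/2"
    using assms(1) by auto
  have u0: "u0 \<in> sobolev s"
    using assms(2) by (simp add: sobolev0_def)
  note deriv = sobolev_has_deriv[OF r(2) u0] and deriv_in = sobolev_deriv[OF r(2) u0]
  have p_in: "p \<in> sobolev2 (s - 1)"
    by (simp add: p_def sobolev2_def sobolev_const)
  have w_in: "w \<in> sobolev2 (s - 1)"
    \<comment> \<open>Scaling by 1/2 is the linear combination with second coefficient 0.\<close>
    using sobolev_linear[OF r(1) deriv_in deriv_in, of "1/2" 0]
      sobolev_linear[OF r(1) assms(3) assms(3), of "1/2" 0]
    by (simp add: assms(4) sobolev2_def)
  have pp: "indef_inner p p = 1"
    by (simp add: p_def indef_inner_eq_integral)
  have "continuous_on UNIV w"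
    unfolding assms(4) by (intro continuous_intros sobolevD(1)[OF deriv_in r(1)] sobolevD(1)[OF assms(3) r(1)])
  then have "indef_inner p w = integral {0..1} (\<lambda>x. deriv u0 x / 2)"
    by (simp add: p_def indef_inner_eq_integral assms(4))
  \<comment> \<open>The initial velocity is tangent at (1, 0) because the derivative of a periodic
    function has integral 0 over a period.\<close>
  also have "(deriv u0 has_integral (u0 1 - u0 0)) {0..1}"
    by (rule fundamental_theorem_of_calculus)
       (auto intro: has_field_derivative_at_within deriv simp flip: has_real_derivative_iff_has_vector_derivative)
  then have "integral {0..1} (\<lambda>x. deriv u0 x / 2) = 0"
    using sobolevD(2)[OF u0 r(3), of 0] by (simp add: integral_unique)
  finally have pw: "indef_inner p w = 0" .
  have c: "c = 1/4 * (LBINT x:{0..1}. (deriv u0 x)\<^sup>2 - (\<rho>0 x)\<^sup>2)"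
  proof -
    have "(\<lambda>x. fst (w x) * fst (w x) - snd (w x) * snd (w x))
        = (\<lambda>x. 1/4 * ((deriv u0 x)\<^sup>2 - (\<rho>0 x)\<^sup>2))"
      by (simp add: assms(4) power2_eq_square algebra_simps)
    then show ?thesis
      by (simp only: assms(5) indef_inner_def set_integral_mult_right)
  qed
  note AB = DERIV_gcos DERIV_gsin gcos_gsin_squared gcos_gsin_0
  have ex: "geodesic_from (s - 1) UNIV p w (\<lambda>t x. gcos c t *\<^sub>R p x + gsin c t *\<^sub>R w x)"
    by (rule geodesic_from_linear[OF r(1) p_in w_in pp pw assms(5) AB])
  have eq: "f t = (\<lambda>x. gcos c t *\<^sub>R p x + gsin c t *\<^sub>R w x)"
    if "open J" "is_interval J" "0 \<in> J" "t \<in> J" "geodesic_from (s - 1) J p w f" for J t f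
    by (rule geodesic_from_eq[OF r(1) that assms(5) AB])
  \<comment> \<open>Equality of total functions is the right notion on the whole line. On a smaller
    J the values outside J are unconstrained, and the formula is proved pointwise on J.\<close>
  have "\<exists>!f. geodesic_from (s - 1) UNIV p w f"
  proof (rule ex1I)
    show "geodesic_from (s - 1) UNIV p w (\<lambda>t x. gcos c t *\<^sub>R p x + gsin c t *\<^sub>R w x)"
      by (rule ex)
    fix f assume "geodesic_from (s - 1) UNIV p w f"
    then show "f = (\<lambda>t x. gcos c t *\<^sub>R p x + gsin c t *\<^sub>R w x)"
      by (intro ext[of f] eq[of UNIV]) simp_all
  qed
  \<comment> \<open>Inserting (1, 0) and w gives the components; the three causal cases are then the
    branches of \<open>gcos\<close> and \<open>gsin\<close>.\<close>
  moreover have "f t = (\<lambda>x. (gcos c t + deriv u0 x / 2 * gsin c t, \<rho>0 x / 2 * gsin c t))"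
    if "open J \<and> is_interval J \<and> 0 \<in> J \<and> geodesic_from (s - 1) J p w f" "t \<in> J" for J t f
    using that by (subst eq[of J]) (auto simp: p_def assms(4))
  ultimately show ?thesis
    unfolding p_def[symmetric] by (intro conjI allI impI ballI c) (simp_all add: gcos_def gsin_def add.commute)
qed

end
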